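(* Let $\epsilon,\delta\in(0,1)$, $\gamma\in(0,1)$, and let the policies satisfy $B<\infty$. Let $q_{\epsilon_{\mathrm{lo}}}(s)$ and $q_{\epsilon_{\mathrm{up}}}(s)$ be the true (real-valued) conditional quantiles of $R$ given $S=s$ at levels $\epsilon_{\mathrm{lo}}$, $\epsilon_{\mathrm{up}}$ under $(S,R)\sim P^{\pi_e}$, and let $C^{\mathrm{oracle}}(s)=[q_{\epsilon_{\mathrm{lo}}}(s),q_{\epsilon_{\mathrm{up}}}(s)]$. Assume: (Consistency) there are sequences $\eta_l=o(1)$ and $\rho_l=o(1)$ as $l\to\infty$ such that, for all sufficiently large $l$, when the training set $\mathcal D^{\mathrm{rs}}_1$ has size $l$ (so that it consists of $l$ i.i.d. draws from $P^{\pi_e}$), $$\mathbb P\Big[\mathbb E\big[(\hat q_{\epsilon_{\mathrm{lo}}}(S_{n+1})-q_{\epsilon_{\mathrm{lo}}}(S_{n+1}))^2\mid \mathcal D^{\mathrm{rs}}_1\big]\le \eta_l/2\Big]\ge 1-\rho_l/2,$$ $$\mathbb P\Big[\mathbb E\big[(\hat q_{\epsilon_{\mathrm{up}}}(S_{n+1})-q_{\epsilon_{\mathrm{up}}}(S_{n+1}))^2\mid \mathcal D^{\mathrm{rs}}_1\big]\le \eta_l/2\Big]\ge 1-\rho_l/2;$$ (Regularity) for $(S,R)\sim P^{\pi_e}$, the random variable $T=\max\{q_{\epsilon_{\mathrm{lo}}}(S)-R,\ R-q_{\epsilon_{\mathrm{up}}}(S)\}$ has a probability density that is bounded away from zero in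 a neighborhood of zero. Then the interval $\hat C_{\tilde\tau}$ produced by the known-behavior-policy procedure described in the context satisfies $$\mathcal L\big(\hat C_{\tilde\tau}(S_{n+1})\,\triangle\, C^{\mathrm{oracle}}(S_{n+1})\big)=o_{\mathbb P}(1)\qquad\text{as } n\to\infty,$$ where $\mathcal L$ is Lebesgue measure on $\mathbb R$ and $\triangle$ is symmetric difference; i.e. the left-hand side converges to $0$ in probability.
   Context: Setting. $\mathcal S$ (contexts) and $\mathcal A$ (actions) are measurable spaces; rewards are real. A policy $\pi$ maps each $s\in\mathcal S$ to a probability distribution $\pi(\cdot\mid s)$ on $\mathcal A$; $\pi(a\mid s)$ denotes its density (or mass function) with respect to a fixed reference measure $\mathrm da$. $P_S$ is a distribution on $\mathcal S$ and $P_R(\cdot\mid s,a)$ is a conditional reward distribution on $\mathbb R$. The behavior policy $\pi_b$ and the target policy $\pi_e$ are given. The data $\mathcal D=\{(S_i,A_i,R_i)\}_{i=1}^n$ are i.i.d. with $S_i\sim P_S$, $A_i\mid S_i\sim \pi_b(\cdot\mid S_i)$, $R_i\mid (S_i,A_i)\sim P_R(\cdot\mid S_i,A_i)$. The target distribution $P^{\pi_e}$ on $\mathcal S\times\mathbb R$ is the law of $(S,R)$ when $S\sim P_S$, $A\mid S\sim\pi_e(\cdot\mid S)$, $R\mid(S,A)\sim P_R(\cdot\mid S,A)$. The test pair $(S_{n+1},R_{n+1})\sim P^{\pi_e}$ is independent of everything used to build the interval. Put $w(s,a)=\pi_e(a\mid s)/\pi_b(a\mid s)$, with $w(s,a)=0$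 if $\pi_e(a\mid s)=\pi_b(a\mid s)=0$, and $B=\inf\{b:\pi_e(a\mid s)\le b\,\pi_b(a\mid s)\text{ for all }(s,a)\}$. Known-behavior-policy procedure. 1. Rejection sampling: let $V_1,\dots,V_n$ be i.i.d. uniform on $[0,1]$, independent of $\mathcal D$. Let $\mathcal D_{\mathrm{rs}}$ consist of the pairs $(S_i,R_i)$ with $V_i\le w(S_i,A_i)/B$, listed in increasing order of $i$; $N_{\mathrm{rs}}$ is their number. (Given $N_{\mathrm{rs}}$, these pairs are i.i.d. from $P^{\pi_e}$.) 2. Split: $\mathcal D_{\mathrm{rs}}$ is split into $\mathcal D^{\mathrm{rs}}_1$ (training) of size $N_{\mathrm{rs}}-M$ and $\mathcal D^{\mathrm{rs}}_2$ (calibration) of size $M=\lceil\gamma N_{\mathrm{rs}}\rceil$; the choice of positions does not depend on the values of the data points. 3. Training: fix quantile levels $\epsilon_{\mathrm{lo}},\epsilon_{\mathrm{up}}\in[0,1]$ with $\epsilon_{\mathrm{up}}-\epsilon_{\mathrm{lo}}=1-\epsilon$. A fixed algorithm without extra randomness maps $\mathcal D^{\mathrm{rs}}_1$ to measurable functions $\hat q_{\epsilon_{\mathrm{lo}}},\hat q_{\epsilon_{\mathrm{up}}}:\mathcal S\to\mathbb R$ (estimates of the conditional quantiles of $R$ given $S$). For $\tau\in\mathbb R\cup\{\infty\}$ put $\hat C_\tau(s)=[\hat q_{\epsilon_{\mathrm{lo}}}(s)-\tau,\ \hat q_{\epsilon_{\mathrm{up}}}(s)+\tau]$ (empty if the lower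 endpoint exceeds the upper; equal to $\mathbb R$ if $\tau=\infty$). 4. Calibration: for $(S_i,R_i)\in\mathcal D^{\mathrm{rs}}_2$ put $\tau_i=\max\{\hat q_{\epsilon_{\mathrm{lo}}}(S_i)-R_i,\ R_i-\hat q_{\epsilon_{\mathrm{up}}}(S_i)\}$; let $\tau_{(1)}\le\dots\le\tau_{(M)}$ be the ordered values (ties broken arbitrarily) and $\tau_{(M+1)}=\infty$. With $F_{\mathrm{Bin}(M,\epsilon)}$ the binomial c.d.f., let $k(M,\epsilon,\delta)=\max\{k\in\{-1,0,\dots,M-1\}: F_{\mathrm{Bin}(M,\epsilon)}(k)\le\delta\}$ (where $F_{\mathrm{Bin}(M,\epsilon)}(-1)=0$). Set $\tilde\tau=\tau_{(M-k(M,\epsilon,\delta))}$. The output is $\hat C_{\tilde\tau}$. *)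

theory Defs
  imports "HOL-Probability.Probability"
begin

section \<open>Policies and laws\<close>

text \<open>
  The context space is the measurable space underlying the probability measure \<open>PS\<close>; the action
  space is the one underlying the reference measure \<open>da\<close>. The kernel condition contains
  that each \<open>\<pi> s\<close> integrates to 1 with respect to \<open>da\<close>.
\<close>

definition policy :: "'s measure \<Rightarrow> 'a measure \<Rightarrow> ('s \<Rightarrow> 'a \<Rightarrow> real) \<Rightarrow> bool" where
  "policy PS da \<pi> \<longleftrightarrow>
     (\<forall>s\<in>space PS. \<forall>a\<in>space da. 0 \<le> \<pi> s a) \<and>
     (\<lambda>(s, a). \<pi> s a) \<in> borel_measurable (PS \<Otimes>\<^sub>M da) \<and>
     (\<lambda>s. density da (\<lambda>a. ennreal (\<pi> s a))) \<in> PS \<rightarrow>\<^sub>M prob_algebra da"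

definition data_law ::
    "'s measure \<Rightarrow> 'a measure \<Rightarrow> ('s \<times> 'a \<Rightarrow> real measure) \<Rightarrow> ('s \<Rightarrow> 'a \<Rightarrow> real)
      \<Rightarrow> ('s \<times> 'a \<times> real) measure" where
  "data_law PS da PR \<pi> =
     PS \<bind> (\<lambda>s. density da (\<lambda>a. ennreal (\<pi> s a)) \<bind> (\<lambda>a. PR (s, a) \<bind>
       (\<lambda>r. return (PS \<Otimes>\<^sub>M da \<Otimes>\<^sub>M borel) (s, a, r))))"

definition target_law ::
    "'s measure \<Rightarrow> 'a measure \<Rightarrow> ('s \<times> 'a \<Rightarrow> real measure) \<Rightarrow> ('s \<Rightarrow> 'a \<Rightarrow> real)
      \<Rightarrow> ('s \<times> real) measure" where
  "target_law PS da PR \<pi> =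
     PS \<bind> (\<lambda>s. density da (\<lambda>a. ennreal (\<pi> s a)) \<bind> (\<lambda>a. PR (s, a) \<bind>
       (\<lambda>r. return (PS \<Otimes>\<^sub>M borel) (s, r))))"

text \<open>The conditional law of the reward given the context \<open>s\<close> under \<open>target_law\<close>.\<close>

definition cond_reward_law ::
    "'a measure \<Rightarrow> ('s \<times> 'a \<Rightarrow> real measure) \<Rightarrow> ('s \<Rightarrow> 'a \<Rightarrow> real) \<Rightarrow> 's \<Rightarrow> real measure" where
  "cond_reward_law da PR \<pi> s =
     density da (\<lambda>a. ennreal (\<pi> s a)) \<bind> (\<lambda>a. PR (s, a))"

text \<open>
  Quantiles need not be unique; the generalized inverse of the distribution function, whenever it
  is finite, satisfies this predicate.
\<close>

definition is_quantile :: "real measure \<Rightarrow> real \<Rightarrow> real \<Rightarrow> bool" where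
  "is_quantile \<mu> p q \<longleftrightarrow> measure \<mu> {..<q} \<le> p \<and> p \<le> measure \<mu> {..q}"

section \<open>Rejection sampling\<close>

text \<open>The infimum is taken in the extended reals, so it is \<open>\<infinity>\<close> if no real bound exists.\<close>

definition ratio_bound ::
    "'s measure \<Rightarrow> 'a measure \<Rightarrow> ('s \<Rightarrow> 'a \<Rightarrow> real) \<Rightarrow> ('s \<Rightarrow> 'a \<Rightarrow> real) \<Rightarrow> ereal" where
  "ratio_bound PS da \<pi>b \<pi>e =
     Inf (ereal ` {b. \<forall>s\<in>space PS. \<forall>a\<in>space da. \<pi>e s a \<le> b * \<pi>b s a})"

text \<open>Division by zero is zero, which is the convention wanted where both densities vanish.\<close>

definition weight :: "('s \<Rightarrow> 'a \<Rightarrow> real) \<Rightarrow> ('s \<Rightarrow> 'a \<Rightarrow> real) \<Rightarrow> 's \<Rightarrow> 'a \<Rightarrow> real" where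
  "weight \<pi>b \<pi>e s a = \<pi>e s a / \<pi>b s a"

definition rs_data ::
    "('s \<Rightarrow> 'a \<Rightarrow> real) \<Rightarrow> real \<Rightarrow> nat \<Rightarrow> (nat \<Rightarrow> 's \<times> 'a \<times> real) \<Rightarrow> (nat \<Rightarrow> real) \<Rightarrow> ('s \<times> real) list" where
  "rs_data w B n d v =
     map (\<lambda>i. case d i of (s, a, r) \<Rightarrow> (s, r))
       (filter (\<lambda>i. case d i of (s, a, r) \<Rightarrow> v i \<le> w s a / B) [0..<n])"

section \<open>Splitting, training and calibration\<close>

text \<open>
  A splitting rule selects, for every size \<open>N\<close> of the accepted sample, the set of calibration
  positions among \<open>0, \<dots>, N - 1\<close>. As a point of \<open>split_space\<close> it may be random.
\<close>

definition calib_size :: "real \<Rightarrow> nat \<Rightarrow> nat" where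
  "calib_size \<gamma> N = nat \<lceil>\<gamma> * real N\<rceil>"

definition split_space :: "real \<Rightarrow> (nat \<Rightarrow> nat set) measure" where
  "split_space \<gamma> =
     (\<Pi>\<^sub>M N\<in>UNIV. count_space {K. K \<subseteq> {..<N} \<and> card K = calib_size \<gamma> N})"

text \<open>
  A training algorithm maps the training list to a function of the context; it is deterministic
  and jointly measurable for every length of the training list.
\<close>

type_synonym 's algorithm = "('s \<times> real) list \<Rightarrow> 's \<Rightarrow> real"

definition measurable_algorithm :: "'s measure \<Rightarrow> 's algorithm \<Rightarrow> bool" where
  "measurable_algorithm PS Q \<longleftrightarrow>
     (\<forall>l. (\<lambda>(x, s). Q (map x [0..<l]) s)
        \<in> borel_measurable ((\<Pi>\<^sub>M i\<in>{..<l}. PS \<Otimes>\<^sub>M borel) \<Otimes>\<^sub>M PS))"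

definition score :: "('s \<Rightarrow> real) \<Rightarrow> ('s \<Rightarrow> real) \<Rightarrow> 's \<times> real \<Rightarrow> real" where
  "score qlo qup = (\<lambda>(s, r). max (qlo s - r) (r - qup s))"

text \<open>For \<open>k = -1\<close> the event is empty and the distribution function is 0.\<close>

definition binom_cdf :: "nat \<Rightarrow> real \<Rightarrow> int \<Rightarrow> real" where
  "binom_cdf m p k = measure_pmf.prob (binomial_pmf m p) {j. int j \<le> k}"

definition calib_index :: "nat \<Rightarrow> real \<Rightarrow> real \<Rightarrow> int" where
  "calib_index m \<epsilon> \<delta> = Max {k \<in> {-1..int m - 1}. binom_cdf m \<epsilon> k \<le> \<delta>}"

text \<open>The \<open>j\<close>-th smallest entry, counted from 1, and \<open>\<infinity>\<close> for \<open>j = length xs + 1\<close>.\<close>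

definition order_stat :: "real list \<Rightarrow> nat \<Rightarrow> ereal" where
  "order_stat xs j = (if j \<le> length xs then ereal (sort xs ! (j - 1)) else \<infinity>)"

definition calib_threshold :: "real \<Rightarrow> real \<Rightarrow> real list \<Rightarrow> ereal" where
  "calib_threshold \<epsilon> \<delta> ts =
     order_stat ts (nat (int (length ts) - calib_index (length ts) \<epsilon> \<delta>))"

definition band :: "('s \<Rightarrow> real) \<Rightarrow> ('s \<Rightarrow> real) \<Rightarrow> ereal \<Rightarrow> 's \<Rightarrow> real set" where
  "band qlo qup \<tau> s =
     {r. ereal (qlo s) - \<tau> \<le> ereal r \<and> ereal r \<le> ereal (qup s) + \<tau>}"

text \<open>\<open>xs\<close> is the accepted sample, \<open>J\<close> the splitting rule.\<close>

definition conformal_interval ::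
    "'s algorithm \<Rightarrow> 's algorithm \<Rightarrow> real \<Rightarrow> real \<Rightarrow> (nat \<Rightarrow> nat set) \<Rightarrow> ('s \<times> real) list
      \<Rightarrow> 's \<Rightarrow> real set" where
  "conformal_interval Qlo Qup \<epsilon> \<delta> J xs =
     (let K = J (length xs);
          train = nths xs (- K);
          calib = nths xs K;
          \<tau> = calib_threshold \<epsilon> \<delta> (map (score (Qlo train) (Qup train)) calib)
      in band (Qlo train) (Qup train) \<tau>)"

section \<open>The probabilistic model\<close>

text \<open>
  On \<open>M\<close> live the data \<open>D i\<close> and the uniform variables \<open>V i\<close> for \<open>i < n\<close>, the splitting rule \<open>J\<close>
  and the test pair \<open>T\<close>. The product form of the joint law says that all of these are mutually
  independent with the stated marginals; the law of \<open>J\<close> is unrestricted.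
\<close>

definition sampling_model ::
    "('s \<times> 'a \<times> real) measure \<Rightarrow> ('s \<times> real) measure \<Rightarrow> real \<Rightarrow> nat \<Rightarrow> 'w measure
      \<Rightarrow> (nat \<Rightarrow> 'w \<Rightarrow> 's \<times> 'a \<times> real) \<Rightarrow> (nat \<Rightarrow> 'w \<Rightarrow> real)
      \<Rightarrow> ('w \<Rightarrow> nat \<Rightarrow> nat set) \<Rightarrow> ('w \<Rightarrow> 's \<times> real) \<Rightarrow> bool" where
  "sampling_model \<mu> \<nu> \<gamma> n M D V J T \<longleftrightarrow>
     prob_space M \<and>
     (\<forall>i<n. D i \<in> M \<rightarrow>\<^sub>M \<mu>) \<and> (\<forall>i<n. V i \<in> M \<rightarrow>\<^sub>M borel) \<and>
     J \<in> M \<rightarrow>\<^sub>M split_space \<gamma> \<and> T \<in> M \<rightarrow>\<^sub>M \<nu> \<and>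
     distr M ((\<Pi>\<^sub>M i\<in>{..<n}. \<mu>) \<Otimes>\<^sub>M (\<Pi>\<^sub>M i\<in>{..<n}. borel) \<Otimes>\<^sub>M split_space \<gamma> \<Otimes>\<^sub>M \<nu>)
         (\<lambda>\<omega>. (\<lambda>i\<in>{..<n}. D i \<omega>, \<lambda>i\<in>{..<n}. V i \<omega>, J \<omega>, T \<omega>))
       = (\<Pi>\<^sub>M i\<in>{..<n}. \<mu>) \<Otimes>\<^sub>M (\<Pi>\<^sub>M i\<in>{..<n}. uniform_measure lborel {0..1}) \<Otimes>\<^sub>M
         distr M (split_space \<gamma>) J \<Otimes>\<^sub>M \<nu>"

text \<open>A training sample of \<open>l\<close> i.i.d. draws from \<open>\<nu>\<close> together with an independent test pair.\<close>

definition train_test :: "('s \<times> real) measure \<Rightarrow> nat \<Rightarrow> ((nat \<Rightarrow> 's \<times> real) \<times> 's \<times> real) measure" where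
  "train_test \<nu> l = (\<Pi>\<^sub>M i\<in>{..<l}. \<nu>) \<Otimes>\<^sub>M \<nu>"

text \<open>
  The conditional expectation of the squared error at the test context given the training sample.
\<close>

definition cond_sq_error ::
    "('s \<times> real) measure \<Rightarrow> 's algorithm \<Rightarrow> ('s \<Rightarrow> real) \<Rightarrow> nat
      \<Rightarrow> (nat \<Rightarrow> 's \<times> real) \<times> 's \<times> real \<Rightarrow> ennreal" where
  "cond_sq_error \<nu> Q q l =
     nn_cond_exp (train_test \<nu> l)
       (vimage_algebra (space (train_test \<nu> l)) fst (\<Pi>\<^sub>M i\<in>{..<l}. \<nu>))
       (\<lambda>(x, s, r). ennreal ((Q (map x [0..<l]) s - q s)\<^sup>2))"

definition consistent_at ::
    "('s \<times> real) measure \<Rightarrow> 's algorithm \<Rightarrow> ('s \<Rightarrow> real) \<Rightarrow> nat \<Rightarrow> real \<Rightarrow> real \<Rightarrow> bool" where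
  "consistent_at \<nu> Q q l \<eta> \<rho> \<longleftrightarrow>
     measure (train_test \<nu> l)
       {z \<in> space (train_test \<nu> l). cond_sq_error \<nu> Q q l z \<le> ennreal (\<eta> / 2)} \<ge> 1 - \<rho> / 2"

text \<open>
  Convergence to 0 in probability; the probability space may change with the index.
\<close>

definition tends_to_zero_in_prob :: "(nat \<Rightarrow> 'w measure) \<Rightarrow> (nat \<Rightarrow> 'w \<Rightarrow> ennreal) \<Rightarrow> bool" where
  "tends_to_zero_in_prob M X \<longleftrightarrow>
     (\<forall>e>0. (\<lambda>n. measure (M n) {\<omega> \<in> space (M n). X n \<omega> > ennreal e}) \<longlonglongrightarrow> 0)"

end

theory Submission
  imports Defs "HOL-Real_Asymp.Real_Asymp"
begin

text \<open>
  Conditionally on the set of accepted indices, the accepted pairs are i.i.d. from the target law,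
  and there are many of them with high probability. On a training set with small risk the empirical
  scores differ from \<open>T = score qlo qup\<close> by little outside an event of small probability. The quantile
  conditions pin down \<open>P(T < 0) \<le> 1 - \<epsilon> \<le> P(T \<le> 0)\<close>, and the lower bound on the density turns this into a
  linear margin on both sides of 0. Since the calibration index is asymptotically \<open>\<epsilon> * m\<close> by
  Hoeffding's inequality for the binomial law, Hoeffding's inequality for the calibration scores
  forces the threshold into any given neighbourhood of 0. The symmetric difference of two intervals
  is controlled by the distances of their endpoints, which are small at an independent test context
  by Markov's inequality.
\<close>

section \<open>Calibration index and order statistics\<close>

text \<open>The procedure acts on a list of random length in which training and calibration
  positions are interleaved by a possibly random rule. Both difficulties are removed by one device:
  for each set \<open>I\<close> of accepted indices and each set \<open>K\<close> of calibration
  positions, the accepted pairs are listed with the training positions first. On the event that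
  exactly \<open>I\<close> is accepted, this list has law
  \<open>p ^ card I * (1 - p) ^ (n - card I)\<close> times a product of copies of the target law, so
  no conditional probabilities are formed and the sum over \<open>I\<close> is a binomial sum. What
  remains is a statement about a fixed split \<open>l + m\<close>; it must hold uniformly for all
  large \<open>l\<close> and \<open>m\<close>, since both are random in the end. The level \<delta>
  leaves no trace in the limit: it moves the calibration index by o(m) only, and the linear margin
  of \<open>T\<close> at 0 converts a rank error of o(m) into a small threshold. The empirical
  scores inherit this margin only up to the quantile error, which is why the threshold is compared
  with \<open>a\<close> while \<open>T\<close> is examined at the smaller level
  \<open>b\<close>.\<close>

lemma binom_cdf_lower_tail:
  assumes "0 < m" "p \<in> {0..1}" "0 \<le> t" "real_of_int k \<le> real m * (p - t)"
  shows "binom_cdf m p k \<le> exp (- 2 * real m * t\<^sup>2)"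
proof -
  interpret binomial_distribution m p by unfold_locales (use assms in auto)
  have "binom_cdf m p k \<le> measure_pmf.prob (binomial_pmf m p) {x. x / m \<le> p - t}"
    unfolding binom_cdf_def
  proof (intro measure_pmf.finite_measure_mono subsetI)
    fix j assume "j \<in> {j. int j \<le> k}"
    then have "real j \<le> real_of_int k" by auto
    then show "j \<in> {x. real x / real m \<le> p - t}"
      using assms by (auto simp: field_simps)
  qed auto
  also have "\<dots> \<le> exp (- 2 * real m * t\<^sup>2)"
    using prob_le'[of t] assms by simp
  finally show ?thesis .
qed

lemma binom_cdf_upper_tail:
  assumes "0 < m" "p \<in> {0..1}" "0 \<le> t" "real m * (p + t) \<le> real_of_int k"
  shows "1 - exp (- 2 * real m * t\<^sup>2) \<le> binom_cdf m p k"
proof -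
  interpret binomial_distribution m p by unfold_locales (use assms in auto)
  have "1 - binom_cdf m p k = measure_pmf.prob (binomial_pmf m p) (UNIV - {j. int j \<le> k})"
    unfolding binom_cdf_def using measure_pmf.prob_compl[of "{j. int j \<le> k}" "binomial_pmf m p"]
    by simp
  also have "\<dots> \<le> measure_pmf.prob (binomial_pmf m p) {x. x / m \<ge> p + t}"
  proof (intro measure_pmf.finite_measure_mono subsetI)
    fix j assume "j \<in> UNIV - {j. int j \<le> k}"
    then have "real_of_int k \<le> real j" by auto
    then have "real m * (p + t) \<le> real j" using assms by linarith
    then show "j \<in> {x. real x / real m \<ge> p + t}"
      using assms by (simp add: field_simps)
  qed auto
  also have "\<dots> \<le> exp (- 2 * real m * t\<^sup>2)"
    using prob_ge'[of t] assms by simp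
  finally show ?thesis by simp
qed

lemma calib_index:
  assumes "0 \<le> \<delta>"
  shows calib_index_range: "calib_index m \<epsilon> \<delta> \<in> {-1..int m - 1}"
    and calib_index_le: "binom_cdf m \<epsilon> (calib_index m \<epsilon> \<delta>) \<le> \<delta>"
    and calib_index_max: "k \<in> {-1..int m - 1} \<Longrightarrow> binom_cdf m \<epsilon> k \<le> \<delta> \<Longrightarrow> k \<le> calib_index m \<epsilon> \<delta>"
proof -
  let ?S = "{k \<in> {-1..int m - 1}. binom_cdf m \<epsilon> k \<le> \<delta>}"
  \<comment> \<open>The value -1 always qualifies, so the maximum ranges over a nonempty finite set
    for every m, m = 0 included.\<close>
  have "{j. int j \<le> - 1} = {}" by auto
  then have "binom_cdf m \<epsilon> (-1) = 0" by (simp add: binom_cdf_def)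
  then have "-1 \<in> ?S" using assms by auto
  moreover have fin: "finite ?S" by (rule finite_subset[of _ "{-1..int m - 1}"]) auto
  ultimately have "calib_index m \<epsilon> \<delta> \<in> ?S"
    unfolding calib_index_def by (intro Max_in) auto
  then show "calib_index m \<epsilon> \<delta> \<in> {-1..int m - 1}"
    and "binom_cdf m \<epsilon> (calib_index m \<epsilon> \<delta>) \<le> \<delta>" by auto
  show "k \<in> {-1..int m - 1} \<Longrightarrow> binom_cdf m \<epsilon> k \<le> \<delta> \<Longrightarrow> k \<le> calib_index m \<epsilon> \<delta>"
    unfolding calib_index_def using fin by (intro Max_ge) auto
qed

text \<open>The binomial distribution function climbs from near 0 to near 1 within a window of width
  o(m) around \<open>\<epsilon> * m\<close>, and a fixed \<delta> strictly between 0 and 1 is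
  crossed inside that window. The lower bound exhibits a k with value at most \<delta>; the upper
  bound refutes a larger index, where the value would exceed \<delta>.\<close>

lemma calib_index_asymptotic:
  assumes "0 < \<epsilon>" "\<epsilon> < 1" "0 < \<delta>" "\<delta> < 1" "0 < t"
  shows "\<forall>\<^sub>F m in sequentially. (\<epsilon> - t) * real m \<le> calib_index m \<epsilon> \<delta> \<and>
           calib_index m \<epsilon> \<delta> \<le> (\<epsilon> + t) * real m"
proof -
  \<comment> \<open>The lower bound uses the deviation t/2: the other half, more than 1 once
    \<open>m * t > 2\<close>, pays for rounding the witness \<open>m * (\<epsilon> - t/2)\<close>
    down to an integer.\<close>
  have "(\<lambda>m. exp (- 2 * real m * (t/2)\<^sup>2)) \<longlonglongrightarrow> 0"
    using assms by real_asymp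
  then have "\<forall>\<^sub>F m in sequentially. exp (- 2 * real m * (t/2)\<^sup>2) < \<delta>"
    using assms by (intro order_tendstoD) auto
  moreover have "(\<lambda>m. exp (- 2 * real m * t\<^sup>2)) \<longlonglongrightarrow> 0"
    using assms by real_asymp
  then have "\<forall>\<^sub>F m in sequentially. exp (- 2 * real m * t\<^sup>2) < 1 - \<delta>"
    using assms by (intro order_tendstoD) auto
  moreover have "\<forall>\<^sub>F m in sequentially. real m > 2 / t"
    using filterlim_real_sequentially by (rule filterlim_at_top_dense[THEN iffD1, rule_format])
  moreover have "\<forall>\<^sub>F m in sequentially. real m > 1 / (1 - \<epsilon>)"
    using filterlim_real_sequentially by (rule filterlim_at_top_dense[THEN iffD1, rule_format])
  ultimately show ?thesis
  proof eventually_elim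
    case (elim m)
    have t2: "real m * t > 2" using elim(3) assms by (simp add: field_simps)
    have "real m > 0" using elim(3) assms by (smt (verit) divide_pos_pos)
    then have m: "m > 0" by simp
    \<comment> \<open>Keeps the witness at most \<open>m - 1\<close>, the top of the range over
      which the index is maximised.\<close>
    have e1: "real m * \<epsilon> < real m - 1" using elim(4) assms by (simp add: field_simps)
    have lower: "(\<epsilon> - t) * real m \<le> calib_index m \<epsilon> \<delta>"
    \<comment> \<open>A witness below -1 is not admissible, but then the claimed lower bound already
      lies below the least possible index.\<close>
    proof (cases "\<lfloor>real m * (\<epsilon> - t/2)\<rfloor> < -1")
      case True
      have "(\<epsilon> - t) * real m \<le> real m * (\<epsilon> - t/2)" using assms m by (simp add: algebra_simps)
      also have "\<dots> < -1" using True by linarith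
      finally show ?thesis using calib_index_range[of \<delta> m \<epsilon>] assms by force
    next
      case False
      let ?k = "\<lfloor>real m * (\<epsilon> - t/2)\<rfloor>"
      have "real_of_int ?k \<le> real m * (\<epsilon> - t/2)" by linarith
      also have "\<dots> \<le> real m * \<epsilon>" using assms m by (simp add: algebra_simps)
      finally have "?k \<le> int m - 1" using e1 by linarith
      moreover have "binom_cdf m \<epsilon> ?k \<le> \<delta>"
        using binom_cdf_lower_tail[of m \<epsilon> "t/2" ?k] m assms elim(1) by simp
      ultimately have "?k \<le> calib_index m \<epsilon> \<delta>"
        using False assms by (intro calib_index_max) auto
      moreover have "real m * (\<epsilon> - t/2) - 1 \<le> ?k" by linarith
      ultimately show ?thesis using t2 by (simp add: algebra_simps)
    qed
    have upper: "calib_index m \<epsilon> \<delta> \<le> (\<epsilon> + t) * real m"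
    proof (rule ccontr)
      assume "\<not> calib_index m \<epsilon> \<delta> \<le> (\<epsilon> + t) * real m"
      then have "1 - exp (- 2 * real m * t\<^sup>2) \<le> binom_cdf m \<epsilon> (calib_index m \<epsilon> \<delta>)"
        using m assms by (intro binom_cdf_upper_tail) (auto simp: mult.commute)
      then show False using calib_index_le[of \<delta> m \<epsilon>] assms elim(2) by auto
    qed
    show ?case using lower upper by blast
  qed
qed

section \<open>Order statistics, interval geometry and binomial sums\<close>

lemma length_filter_sort:
  "length (filter P xs) = card {i. i < length xs \<and> P (sort xs ! i)}"
proof -
  have "length (filter P xs) = size (filter_mset P (mset xs))"
    by (metis mset_filter size_mset)
  also have "\<dots> = length (filter P (sort xs))"
    by (metis mset_filter size_mset mset_sort)
  also have "\<dots> = card {i. i < length xs \<and> P (sort xs ! i)}"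
    by (simp add: length_filter_conv_card)
  finally show ?thesis .
qed

lemma order_stat_greater:
  assumes "1 \<le> j" "j \<le> length xs + 1" "ereal a < order_stat xs j"
  shows "length (filter (\<lambda>x. x \<le> a) xs) < j"
proof (cases "j \<le> length xs")
  case True
  have "a < sort xs ! (j - 1)" using assms True by (simp add: order_stat_def)
  then have "{i. i < length xs \<and> sort xs ! i \<le> a} \<subseteq> {..<j - 1}"
  proof safe
    fix i assume i: "i < length xs" "sort xs ! i \<le> a"
    show "i < j - 1"
    proof (rule ccontr)
      assume "\<not> i < j - 1"
      then have "sort xs ! (j - 1) \<le> sort xs ! i"
        using i by (intro sorted_nth_mono) auto
      then show False using i \<open>a < sort xs ! (j - 1)\<close> by linarith
    qed
  qed
  then have "card {i. i < length xs \<and> sort xs ! i \<le> a} \<le> card {..<j - 1}"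
    by (intro card_mono) auto
  then show ?thesis using assms by (simp add: length_filter_sort)
next
  \<comment> \<open>Only \<open>j = length xs + 1\<close> remains, where the statistic is infinite
    and the count of all entries is still below j.\<close>
  case False
  then show ?thesis using assms length_filter_le[of "\<lambda>x. x \<le> a" xs] by linarith
qed

lemma order_stat_less:
  assumes "1 \<le> j" "order_stat xs j < ereal b"
  shows "j \<le> length (filter (\<lambda>x. x < b) xs)"
proof -
  have j: "j \<le> length xs" using assms by (auto simp: order_stat_def split: if_splits)
  then have "sort xs ! (j - 1) < b" using assms by (simp add: order_stat_def)
  then have "{..<j} \<subseteq> {i. i < length xs \<and> sort xs ! i < b}"
  proof safe
    fix i assume "i < j"
    then have "sort xs ! i \<le> sort xs ! (j - 1)"
      using j by (intro sorted_nth_mono) auto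
    then show "sort xs ! i < b" using \<open>sort xs ! (j - 1) < b\<close> by linarith
  qed (use j in auto)
  then have "card {..<j} \<le> card {i. i < length xs \<and> sort xs ! i < b}"
    by (intro card_mono) auto
  then show ?thesis by (simp add: length_filter_sort)
qed

text \<open>A point in exactly one of the two intervals lies between the two lower or between the
  two upper endpoints; this remains true if an interval is empty, so no order of the endpoints is
  required. Each pair of endpoints is at most \<open>2 * a\<close> apart, one a for the quantile
  error and one for \<tau>.\<close>

lemma emeasure_sym_diff_band_le:
  assumes "\<bar>\<tau>\<bar> \<le> ereal a" "\<bar>f s - g s\<bar> \<le> a" "\<bar>f' s - g' s\<bar> \<le> a"
  shows "emeasure lborel (sym_diff (band f f' \<tau> s) {g s..g' s}) \<le> ennreal (4 * a)"
proof -
  obtain t where t: "\<tau> = ereal t" using assms by (cases \<tau>) auto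
  then have "\<bar>t\<bar> \<le> a" using assms by simp
  let ?I = "{min (f s - t) (g s)..max (f s - t) (g s)}"
  let ?J = "{min (f' s + t) (g' s)..max (f' s + t) (g' s)}"
  have "emeasure lborel (sym_diff (band f f' \<tau> s) {g s..g' s}) \<le> emeasure lborel (?I \<union> ?J)"
    by (intro emeasure_mono) (auto simp: band_def t)
  also have "\<dots> \<le> emeasure lborel ?I + emeasure lborel ?J"
    by (intro emeasure_subadditive) auto
  also have "\<dots> \<le> ennreal (2 * a) + ennreal (2 * a)"
    using assms \<open>\<bar>t\<bar> \<le> a\<close> by (intro add_mono) (auto simp: min_def max_def intro!: ennreal_leI)
  also have "\<dots> = ennreal (4 * a)"
    using assms by (subst ennreal_plus[symmetric]) auto
  finally show ?thesis .
qed

lemma score_perturbation: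
  assumes "\<bar>f s - g s\<bar> \<le> a" "\<bar>f' s - g' s\<bar> \<le> a"
  shows "\<bar>score f f' (s, r) - score g g' (s, r)\<bar> \<le> a"
  using assms by (auto simp: score_def)

text \<open>The summand is the probability that exactly the indices in I succeed in n independent
  trials; grouping by size gives the binomial law. It serves for the accepted sets that are too
  small and, with k = n + 1, for the total mass.\<close>

lemma sum_subsets_eq_binom_cdf:
  fixes p :: real
  assumes "0 \<le> p" "p \<le> 1"
  shows "(\<Sum>I | I \<subseteq> {..<n} \<and> card I < k. p ^ card I * (1 - p) ^ (n - card I)) = binom_cdf n p (int k - 1)"
proof -
  let ?S = "{I. I \<subseteq> {..<n} \<and> card I < k}"
  have fin: "finite ?S" by (rule finite_subset[of _ "Pow {..<n}"]) auto
  have "(\<Sum>I\<in>?S. p ^ card I * (1 - p) ^ (n - card I)) =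
     (\<Sum>j<k. \<Sum>I | I \<in> ?S \<and> card I = j. p ^ card I * (1 - p) ^ (n - card I))"
    using fin by (intro sum.group[symmetric]) auto
  also have "\<dots> = (\<Sum>j<k. real (n choose j) * p ^ j * (1 - p) ^ (n - j))"
  proof (intro sum.cong refl)
    fix j assume "j \<in> {..<k}"
    then have "{I. I \<in> ?S \<and> card I = j} = {I. I \<subseteq> {..<n} \<and> card I = j}" by auto
    moreover have "card {I. I \<subseteq> {..<n} \<and> card I = j} = n choose j"
      using n_subsets[of "{..<n}" j] by simp
    ultimately show "(\<Sum>I | I \<in> ?S \<and> card I = j. p ^ card I * (1 - p) ^ (n - card I)) =
         real (n choose j) * p ^ j * (1 - p) ^ (n - j)" by simp
  qed
  also have "\<dots> = (\<Sum>j<k. pmf (binomial_pmf n p) j)"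
    using assms by (intro sum.cong) auto
  also have "\<dots> = measure_pmf.prob (binomial_pmf n p) {..<k}"
    by (simp add: measure_measure_pmf_finite)
  also have "{..<k} = {j. int j \<le> int k - 1}" by auto
  finally show ?thesis by (simp add: binom_cdf_def)
qed

lemma binom_cdf_tendsto_0:
  assumes "0 < p" "p \<le> 1"
  shows "(\<lambda>n. binom_cdf n p k) \<longlonglongrightarrow> 0"
proof (rule Lim_null_comparison)
  \<comment> \<open>With deviation p/2 the tail bound applies as soon as k lies below half the mean
    \<open>n * p\<close>, which happens eventually because k is fixed.\<close>
  show "(\<lambda>n. exp (- 2 * real n * (p/2)\<^sup>2)) \<longlonglongrightarrow> 0"
    using assms by real_asymp
  have "\<forall>\<^sub>F n in sequentially. real n > max 0 (2 * real_of_int k / p)"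
    using filterlim_real_sequentially by (rule filterlim_at_top_dense[THEN iffD1, rule_format])
  then show "\<forall>\<^sub>F n in sequentially. norm (binom_cdf n p k) \<le> exp (- 2 * real n * (p/2)\<^sup>2)"
  proof eventually_elim
    case (elim n)
    then have "real n > 0" "2 * real_of_int k / p < real n" by auto
    moreover from this have "2 * real_of_int k < real n * p" using assms by (simp add: field_simps)
    ultimately have "binom_cdf n p k \<le> exp (- 2 * real n * (p/2)\<^sup>2)"
      using assms by (intro binom_cdf_lower_tail) auto
    then show ?case by (simp add: binom_cdf_def)
  qed
qed

section \<open>Concentration of the calibrated threshold\<close>

lemma Hoeffding_PiM_count:
  assumes "prob_space \<nu>" "finite J" "J \<noteq> {}" "0 \<le> t" and P[measurable]: "Measurable.pred \<nu> P"
  defines "p \<equiv> measure \<nu> {x \<in> space \<nu>. P x}" and "m \<equiv> real (card J)"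
  shows "measure (\<Pi>\<^sub>M i\<in>J. \<nu>) {z \<in> space (\<Pi>\<^sub>M i\<in>J. \<nu>). (\<Sum>j\<in>J. of_bool (P (z j))) \<le> m * (p - t)} \<le> exp (- 2 * m * t\<^sup>2)"
    and "measure (\<Pi>\<^sub>M i\<in>J. \<nu>) {z \<in> space (\<Pi>\<^sub>M i\<in>J. \<nu>). m * (p + t) \<le> (\<Sum>j\<in>J. of_bool (P (z j)))} \<le> exp (- 2 * m * t\<^sup>2)"
proof -
  interpret \<nu>: prob_space \<nu> by fact
  let ?Pi = "\<Pi>\<^sub>M i\<in>J. \<nu>"
  interpret Pi: prob_space ?Pi by (intro prob_space_PiM \<nu>.prob_space_axioms)
  obtain j0 where j0: "j0 \<in> J" using assms by blast
  have comp: "distr ?Pi \<nu> (\<lambda>z. z j) = \<nu>" if "j \<in> J" for j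
    using that by (intro distr_PiM_component \<nu>.prob_space_axioms)
  have ind: "Pi.indep_vars (\<lambda>_. borel) (\<lambda>j z. of_bool (P (z j)) :: real) J"
  proof -
    have "Pi.indep_vars (\<lambda>_. \<nu>) (\<lambda>j z. z j) J"
    proof (subst Pi.indep_vars_iff_distr_eq_PiM'[OF assms(3)])
      have "distr ?Pi ?Pi (\<lambda>x. \<lambda>i\<in>J. x i) = distr ?Pi ?Pi (\<lambda>x. x)"
        by (intro distr_cong) (auto simp: space_PiM)
      then show "distr ?Pi ?Pi (\<lambda>x. \<lambda>i\<in>J. x i) = (\<Pi>\<^sub>M i\<in>J. distr ?Pi \<nu> (\<lambda>z. z i))"
        by (simp add: comp distr_id cong: PiM_cong)
    qed (rule measurable_component_singleton)
    then show ?thesis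
      by (rule Pi.indep_vars_compose2) measurable
  qed
  have distr_of_bool: "distr ?Pi borel (\<lambda>z. of_bool (P (z j)) :: real) = distr \<nu> borel (\<lambda>x. of_bool (P x))"
    if "j \<in> J" for j
    by (subst comp[OF that, symmetric], subst distr_distr) (use that in \<open>auto simp: o_def\<close>)
  interpret Hoeffding_ineq_iid ?Pi J "\<lambda>j z. of_bool (P (z j))" "\<lambda>z. of_bool (P (z j0))" 0 1 p
  proof unfold_locales
    have "(\<integral>z. of_bool (P (z j0)) \<partial>?Pi) = (\<integral>x. (of_bool (P x) :: real) \<partial>distr ?Pi \<nu> (\<lambda>z. z j0))"
      using j0 by (subst integral_distr) auto
    also have "\<dots> = (\<integral>x. indicator {x \<in> space \<nu>. P x} x \<partial>\<nu>)"
      unfolding comp[OF j0] by (intro Bochner_Integration.integral_cong) auto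
    also have "\<dots> = p" by (simp add: p_def)
    finally show "p \<equiv> (\<integral>z. of_bool (P (z j0)) \<partial>?Pi)" by simp
  qed (use assms j0 ind distr_of_bool in auto)
  have m: "m > 0" using assms by (simp add: m_def card_gt_0_iff)
  \<comment> \<open>The locale measures deviations of the sum, hence \<open>m * t\<close> in place
    of t and the rewriting of its exponent.\<close>
  have t: "0 \<le> m * t" using m assms by simp
  have e: "2 * (m * t)\<^sup>2 / m = 2 * m * t\<^sup>2" using m by (simp add: power2_eq_square)
  show "measure ?Pi {z \<in> space ?Pi. (\<Sum>j\<in>J. of_bool (P (z j))) \<le> m * (p - t)} \<le> exp (- 2 * m * t\<^sup>2)"
    using Hoeffding_ineq_le[OF t _ assms(3)] unfolding m_def[symmetric]
    by (simp add: right_diff_distrib e)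
  show "measure ?Pi {z \<in> space ?Pi. m * (p + t) \<le> (\<Sum>j\<in>J. of_bool (P (z j)))} \<le> exp (- 2 * m * t\<^sup>2)"
    using Hoeffding_ineq_ge[OF t _ assms(3)] unfolding m_def[symmetric]
    by (simp add: distrib_left e)
qed

text \<open>The hypotheses bound the mass of the closed and of the open half-line at 0. Moving the
  cut to the right adds, and moving it to the left removes, the mass of an interval of length t,
  which the density bound makes at least \<open>c * t\<close>.\<close>

lemma score_margin:
  assumes "prob_space \<nu>" and f: "distributed \<nu> lborel T f" and c: "0 < c"
    and ev: "\<forall>\<^sub>F t in nhds (0::real). ennreal c \<le> f t"
    and lower: "p \<le> measure \<nu> {x \<in> space \<nu>. T x \<le> 0}"
    and upper: "measure \<nu> {x \<in> space \<nu>. T x < 0} \<le> p"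
  shows "\<exists>t0>0. \<forall>t. 0 < t \<longrightarrow> t \<le> t0 \<longrightarrow> p + c * t \<le> measure \<nu> {x \<in> space \<nu>. T x \<le> t} \<and>
    measure \<nu> {x \<in> space \<nu>. T x < - t} \<le> p - c * t"
proof -
  interpret prob_space \<nu> by fact
  obtain e where e: "e > 0" "\<And>t. \<bar>t\<bar> < e \<Longrightarrow> ennreal c \<le> f t"
    using ev by (auto simp: eventually_nhds_metric dist_real_def)
  have T[measurable]: "T \<in> borel_measurable \<nu>" using distributed_measurable[OF f] by simp
  \<comment> \<open>The two uses are half-open intervals on opposite sides of 0, so the bound is
    stated for any Borel set between the open and the closed interval.\<close>
  have interval: "c * (v - u) \<le> prob {x \<in> space \<nu>. T x \<in> I}"
    if uv: "u \<le> v" "{u<..<v} \<subseteq> I" "I \<subseteq> {u..v}" "-e < u" "v < e" and I[measurable]: "I \<in> sets borel" for u v I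
  proof -
    have eI: "emeasure lborel I = ennreal (v - u)"
      using uv emeasure_mono[OF uv(2), of lborel] emeasure_mono[OF uv(3), of lborel] by (auto intro: antisym)
    have "ennreal (c * (v - u)) = (\<integral>\<^sup>+t. ennreal c * indicator I t \<partial>lborel)"
      using c uv eI by (simp add: nn_integral_cmult_indicator ennreal_mult)
    also have "\<dots> \<le> (\<integral>\<^sup>+t. f t * indicator I t \<partial>lborel)"
      using e(2) uv by (intro nn_integral_mono) (force split: split_indicator)
    also have "\<dots> = emeasure \<nu> (T -` I \<inter> space \<nu>)"
      using distributed_emeasure[OF f, of I] by simp
    also have "T -` I \<inter> space \<nu> = {x \<in> space \<nu>. T x \<in> I}" by auto
    finally show ?thesis by (simp add: emeasure_eq_measure)
  qed
  show ?thesis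
  \<comment> \<open>Halving e keeps the closed interval from -t to t strictly inside the
    neighbourhood on which the density is bounded below.\<close>
  proof (intro exI[of _ "e / 2"] conjI allI impI)
    fix t assume t: "0 < t" "t \<le> e / 2"
    have "{x \<in> space \<nu>. T x \<le> t} = {x \<in> space \<nu>. T x \<le> 0} \<union> {x \<in> space \<nu>. T x \<in> {0<..t}}"
      using t by auto
    moreover have "prob ({x \<in> space \<nu>. T x \<le> 0} \<union> {x \<in> space \<nu>. T x \<in> {0<..t}}) =
       prob {x \<in> space \<nu>. T x \<le> 0} + prob {x \<in> space \<nu>. T x \<in> {0<..t}}"
      by (intro finite_measure_Union) auto
    moreover have "c * (t - 0) \<le> prob {x \<in> space \<nu>. T x \<in> {0<..t}}"
      using t e by (intro interval) auto
    ultimately show "p + c * t \<le> prob {x \<in> space \<nu>. T x \<le> t}" using lower by simp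
    have "{x \<in> space \<nu>. T x < 0} = {x \<in> space \<nu>. T x < - t} \<union> {x \<in> space \<nu>. T x \<in> {-t..<0}}"
      using t by auto
    moreover have "prob ({x \<in> space \<nu>. T x < - t} \<union> {x \<in> space \<nu>. T x \<in> {-t..<0}}) =
       prob {x \<in> space \<nu>. T x < - t} + prob {x \<in> space \<nu>. T x \<in> {-t..<0}}"
      by (intro finite_measure_Union) auto
    moreover have "c * (0 - (-t)) \<le> prob {x \<in> space \<nu>. T x \<in> {-t..<0}}"
      using t e by (intro interval) auto
    ultimately show "prob {x \<in> space \<nu>. T x < - t} \<le> p - c * t" using upper by simp
  qed (use e in auto)
qed

section \<open>Training risk and the consistency hypothesis\<close>

lemma measurable_algorithm_compose:
  assumes Q: "measurable_algorithm PS Q" and \<nu>: "sets \<nu> = sets (PS \<Otimes>\<^sub>M borel)" and l: "{..<l} \<subseteq> I"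
    and f[measurable]: "f \<in> N \<rightarrow>\<^sub>M (\<Pi>\<^sub>M i\<in>I. \<nu>)" and g[measurable]: "g \<in> N \<rightarrow>\<^sub>M PS"
  shows "(\<lambda>x. Q (map (f x) [0..<l]) (g x)) \<in> borel_measurable N"
proof -
  \<comment> \<open>\<open>measurable_algorithm\<close> is stated for exactly l coordinates, whereas
    f may carry a longer sample; cutting down to the first l coordinates leaves the training list
    unchanged.\<close>
  have "(\<lambda>x. restrict (f x) {..<l}) \<in> N \<rightarrow>\<^sub>M (\<Pi>\<^sub>M i\<in>{..<l}. \<nu>)"
    by (rule measurable_compose[OF f measurable_restrict_subset[OF l]])
  also have "sets (\<Pi>\<^sub>M i\<in>{..<l}. \<nu>) = sets (\<Pi>\<^sub>M i\<in>{..<l}. PS \<Otimes>\<^sub>M (borel :: real measure))"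
    by (intro sets_PiM_cong refl \<nu>)
  then have "N \<rightarrow>\<^sub>M (\<Pi>\<^sub>M i\<in>{..<l}. \<nu>) = N \<rightarrow>\<^sub>M (\<Pi>\<^sub>M i\<in>{..<l}. PS \<Otimes>\<^sub>M (borel :: real measure))"
    by (intro measurable_cong_sets refl)
  finally have [measurable]: "(\<lambda>x. restrict (f x) {..<l}) \<in> N \<rightarrow>\<^sub>M (\<Pi>\<^sub>M i\<in>{..<l}. PS \<Otimes>\<^sub>M (borel :: real measure))" .
  have "(\<lambda>x. (restrict (f x) {..<l}, g x)) \<in> N \<rightarrow>\<^sub>M (\<Pi>\<^sub>M i\<in>{..<l}. PS \<Otimes>\<^sub>M (borel :: real measure)) \<Otimes>\<^sub>M PS"
    by measurable
  moreover have "(\<lambda>(x, s). Q (map x [0..<l]) s) \<in> borel_measurable ((\<Pi>\<^sub>M i\<in>{..<l}. PS \<Otimes>\<^sub>M borel) \<Otimes>\<^sub>M PS)"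
    using Q unfolding measurable_algorithm_def by blast
  ultimately have "(\<lambda>x. case (restrict (f x) {..<l}, g x) of (x, s) \<Rightarrow> Q (map x [0..<l]) s) \<in> borel_measurable N"
    by (rule measurable_compose)
  moreover have "map (restrict h {..<l}) [0..<l] = map h [0..<l]" for h :: "nat \<Rightarrow> 'a \<times> real"
    by auto
  ultimately show ?thesis by simp
qed

text \<open>The risk at a fixed training list, hence a genuine function of that list. It replaces
  the conditional expectation, which is determined only almost everywhere and lives on the space
  that also carries the test pair.\<close>

definition sq_risk ::
    "('s \<times> real) measure \<Rightarrow> 's algorithm \<Rightarrow> ('s \<Rightarrow> real) \<Rightarrow> ('s \<times> real) list \<Rightarrow> ennreal" where
  "sq_risk \<nu> Q q xs = (\<integral>\<^sup>+(s, r). ennreal ((Q xs s - q s)\<^sup>2) \<partial>\<nu>)"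

lemma borel_measurable_sq_risk:
  assumes "prob_space \<nu>" and Q: "measurable_algorithm PS Q"
    and \<nu>[measurable_cong]: "sets \<nu> = sets (PS \<Otimes>\<^sub>M borel)" and l: "{..<l} \<subseteq> I"
    and q[measurable]: "q \<in> borel_measurable PS"
  shows "(\<lambda>x. sq_risk \<nu> Q q (map x [0..<l])) \<in> borel_measurable (\<Pi>\<^sub>M i\<in>I. \<nu>)"
proof -
  interpret prob_space \<nu> by fact
  have [measurable]: "(\<lambda>(x, y). Q (map x [0..<l]) (fst y)) \<in> borel_measurable ((\<Pi>\<^sub>M i\<in>I. \<nu>) \<Otimes>\<^sub>M \<nu>)"
    unfolding split_beta
    by (rule measurable_algorithm_compose[OF Q \<nu> l]) measurable
  have [measurable]: "(\<lambda>(x, y). q (fst y)) \<in> borel_measurable ((\<Pi>\<^sub>M i\<in>I. \<nu>) \<Otimes>\<^sub>M \<nu>)"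
    by measurable
  show ?thesis unfolding sq_risk_def split_beta
    by (rule borel_measurable_nn_integral) measurable
qed

text \<open>Since training sample and test pair are independent, integrating out the test pair gives
  a version of the conditional expectation. Every conditioning event is a cylinder over a set of
  training samples, so the defining identity is Tonelli's theorem.\<close>

lemma cond_sq_error_eq_sq_risk:
  assumes "prob_space \<nu>" and Q: "measurable_algorithm PS Q"
    and \<nu>[measurable_cong]: "sets \<nu> = sets (PS \<Otimes>\<^sub>M borel)"
    and q[measurable]: "q \<in> borel_measurable PS"
  shows "AE z in train_test \<nu> l. sq_risk \<nu> Q q (map (fst z) [0..<l]) = cond_sq_error \<nu> Q q l z"
proof -
  let ?P = "\<Pi>\<^sub>M i\<in>{..<l}. \<nu>"
  let ?M = "train_test \<nu> l"
  let ?F = "vimage_algebra (space ?M) fst ?P"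
  interpret \<nu>: prob_space \<nu> by fact
  interpret P: prob_space ?P by (intro prob_space_PiM \<nu>.prob_space_axioms)
  interpret PP: pair_prob_space ?P \<nu> ..
  have M: "?M = ?P \<Otimes>\<^sub>M \<nu>" by (simp add: train_test_def)
  interpret finite_measure_subalgebra ?M ?F
  proof (intro finite_measure_subalgebra.intro finite_measure_subalgebra_axioms.intro)
    show "finite_measure ?M" unfolding M by unfold_locales
    have "fst \<in> ?M \<rightarrow>\<^sub>M ?P" unfolding M by measurable
    then have "fst -` A \<inter> space ?M \<in> sets ?M" if "A \<in> sets ?P" for A
      using that by (rule measurable_sets)
    moreover have "fst \<in> space ?M \<rightarrow> space ?P" by (auto simp: M space_pair_measure)
    ultimately show "subalgebra ?M ?F"
      by (auto simp: subalgebra_def sets_vimage_algebra2)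
  qed
  note [measurable] = borel_measurable_sq_risk[OF assms(1) Q \<nu> subset_refl q]
  have [measurable]: "(\<lambda>(x, y). Q (map x [0..<l]) (fst y)) \<in> borel_measurable (?P \<Otimes>\<^sub>M \<nu>)"
    unfolding split_beta by (rule measurable_algorithm_compose[OF Q \<nu> subset_refl]) measurable
  have f[measurable]: "(\<lambda>(x, s, r). ennreal ((Q (map x [0..<l]) s - q s)\<^sup>2)) \<in> borel_measurable (?P \<Otimes>\<^sub>M \<nu>)"
    unfolding split_beta by measurable
  show ?thesis
    unfolding cond_sq_error_def
  proof (rule nn_cond_exp_charact)
    show "(\<lambda>(x, s, r). ennreal ((Q (map x [0..<l]) s - q s)\<^sup>2)) \<in> borel_measurable ?M"
      unfolding M by (rule f)
    show "(\<lambda>z. sq_risk \<nu> Q q (map (fst z) [0..<l])) \<in> borel_measurable ?F"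
    proof (rule measurable_compose[of fst _ ?P])
      show "fst \<in> ?F \<rightarrow>\<^sub>M ?P"
        by (rule measurable_vimage_algebra1) (auto simp: M space_pair_measure)
    qed measurable
    fix A assume "A \<in> sets ?F"
    then obtain B where B[measurable]: "B \<in> sets ?P" and A: "A = fst -` B \<inter> space ?M"
      by (subst (asm) sets_vimage_algebra2) (auto simp: M space_pair_measure)
    have "(\<integral>\<^sup>+z\<in>A. (case z of (x, s, r) \<Rightarrow> ennreal ((Q (map x [0..<l]) s - q s)\<^sup>2)) \<partial>?M) =
       (\<integral>\<^sup>+z. (case z of (x, s, r) \<Rightarrow> ennreal ((Q (map x [0..<l]) s - q s)\<^sup>2)) * indicator B (fst z) \<partial>(?P \<Otimes>\<^sub>M \<nu>))"
      unfolding A M by (intro nn_integral_cong) (auto split: split_indicator)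
    also have "\<dots> = (\<integral>\<^sup>+x. \<integral>\<^sup>+(s, r). ennreal ((Q (map x [0..<l]) s - q s)\<^sup>2) * indicator B x \<partial>\<nu> \<partial>?P)"
      by (subst \<nu>.nn_integral_fst[symmetric]) (auto simp: split_beta')
    also have "\<dots> = (\<integral>\<^sup>+x. sq_risk \<nu> Q q (map x [0..<l]) * indicator B x \<partial>?P)"
      unfolding sq_risk_def
    proof (intro nn_integral_cong)
      fix x assume x: "x \<in> space ?P"
      show "(\<integral>\<^sup>+(s, r). ennreal ((Q (map x [0..<l]) s - q s)\<^sup>2) * indicator B x \<partial>\<nu>) =
        (\<integral>\<^sup>+(s, r). ennreal ((Q (map x [0..<l]) s - q s)\<^sup>2) \<partial>\<nu>) * indicator B x"
        by (cases "x \<in> B") (simp_all add: case_prod_unfold)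
    qed
    \<comment> \<open>The risk is constant in the test pair; averaging it over the probability
      measure \<nu> restores an integral over the product space.\<close>
    also have "\<dots> = (\<integral>\<^sup>+x. \<integral>\<^sup>+y. sq_risk \<nu> Q q (map x [0..<l]) * indicator B x \<partial>\<nu> \<partial>?P)"
      by (simp add: \<nu>.emeasure_space_1)
    also have "\<dots> = (\<integral>\<^sup>+z. sq_risk \<nu> Q q (map (fst z) [0..<l]) * indicator B (fst z) \<partial>(?P \<Otimes>\<^sub>M \<nu>))"
      by (subst \<nu>.nn_integral_fst[symmetric]) auto
    also have "\<dots> = (\<integral>\<^sup>+z\<in>A. sq_risk \<nu> Q q (map (fst z) [0..<l]) \<partial>?M)"
      unfolding A M by (intro nn_integral_cong) (auto split: split_indicator)
    finally show "(\<integral>\<^sup>+z\<in>A. (case z of (x, s, r) \<Rightarrow> ennreal ((Q (map x [0..<l]) s - q s)\<^sup>2)) \<partial>?M) =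
       (\<integral>\<^sup>+z\<in>A. sq_risk \<nu> Q q (map (fst z) [0..<l]) \<partial>?M)" .
  qed
qed

text \<open>After the conditional expectation is replaced by \<open>sq_risk\<close>, the event no
  longer involves the test pair: it is a cylinder whose probability is that of its base under the
  training law. The complement is recorded, ready for union bounds.\<close>

lemma consistent_at_sq_risk:
  assumes "prob_space \<nu>" and Q: "measurable_algorithm PS Q"
    and \<nu>[measurable_cong]: "sets \<nu> = sets (PS \<Otimes>\<^sub>M borel)"
    and q[measurable]: "q \<in> borel_measurable PS"
    and cons: "consistent_at \<nu> Q q l \<eta> \<rho>"
  shows "measure (\<Pi>\<^sub>M i\<in>{..<l}. \<nu>)
    {x \<in> space (\<Pi>\<^sub>M i\<in>{..<l}. \<nu>). \<not> sq_risk \<nu> Q q (map x [0..<l]) \<le> ennreal (\<eta> / 2)} \<le> \<rho> / 2"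
proof -
  let ?P = "\<Pi>\<^sub>M i\<in>{..<l}. \<nu>"
  interpret \<nu>: prob_space \<nu> by fact
  interpret P: prob_space ?P by (intro prob_space_PiM \<nu>.prob_space_axioms)
  interpret PP: pair_prob_space ?P \<nu> ..
  note [measurable] = borel_measurable_sq_risk[OF assms(1) Q \<nu> subset_refl q]
  have M: "train_test \<nu> l = ?P \<Otimes>\<^sub>M \<nu>" by (simp add: train_test_def)
  have [measurable]: "cond_sq_error \<nu> Q q l \<in> borel_measurable (?P \<Otimes>\<^sub>M \<nu>)"
    unfolding cond_sq_error_def M by (rule borel_measurable_nn_cond_exp2)
  let ?G = "{x \<in> space ?P. sq_risk \<nu> Q q (map x [0..<l]) \<le> ennreal (\<eta> / 2)}"
  have "1 - \<rho> / 2 \<le> PP.prob {z \<in> space (?P \<Otimes>\<^sub>M \<nu>). cond_sq_error \<nu> Q q l z \<le> ennreal (\<eta> / 2)}"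
    using cons by (simp add: consistent_at_def M)
  also have "\<dots> = PP.prob {z \<in> space (?P \<Otimes>\<^sub>M \<nu>). sq_risk \<nu> Q q (map (fst z) [0..<l]) \<le> ennreal (\<eta> / 2)}"
    using cond_sq_error_eq_sq_risk[OF assms(1) Q \<nu> q, of l] unfolding M
    by (intro PP.finite_measure_eq_AE) auto
  also have "{z \<in> space (?P \<Otimes>\<^sub>M \<nu>). sq_risk \<nu> Q q (map (fst z) [0..<l]) \<le> ennreal (\<eta> / 2)} = ?G \<times> space \<nu>"
    by (auto simp: space_pair_measure)
  also have "PP.prob (?G \<times> space \<nu>) = P.prob ?G"
    by (simp add: measure_def \<nu>.emeasure_pair_measure_Times \<nu>.emeasure_space_1)
  finally have "1 - P.prob ?G \<le> \<rho> / 2" by simp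
  moreover have "{x \<in> space ?P. \<not> sq_risk \<nu> Q q (map x [0..<l]) \<le> ennreal (\<eta> / 2)} = space ?P - ?G"
    by auto
  ultimately show ?thesis by (simp add: P.prob_compl)
qed

lemma sq_risk_Markov:
  assumes "prob_space \<nu>" and Q: "measurable_algorithm PS Q"
    and \<nu>[measurable_cong]: "sets \<nu> = sets (PS \<Otimes>\<^sub>M borel)"
    and q[measurable]: "q \<in> borel_measurable PS"
    and x: "x \<in> space (\<Pi>\<^sub>M i\<in>{..<l}. \<nu>)"
    and risk: "sq_risk \<nu> Q q (map x [0..<l]) \<le> ennreal \<kappa>" and "0 \<le> \<kappa>" "0 < a"
  shows "measure \<nu> {y \<in> space \<nu>. a < \<bar>Q (map x [0..<l]) (fst y) - q (fst y)\<bar>} \<le> \<kappa> / a\<^sup>2"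
proof -
  interpret \<nu>: prob_space \<nu> by fact
  let ?S = "{y \<in> space \<nu>. a < \<bar>Q (map x [0..<l]) (fst y) - q (fst y)\<bar>}"
  have "(\<lambda>y. Q (map ((\<lambda>_. x) y) [0..<l]) (fst y)) \<in> borel_measurable \<nu>"
    using x by (intro measurable_algorithm_compose[OF Q \<nu> subset_refl]) auto
  then have [measurable]: "(\<lambda>y. Q (map x [0..<l]) (fst y)) \<in> borel_measurable \<nu>" by simp
  have S[measurable]: "?S \<in> sets \<nu>" by measurable
  have "ennreal (a\<^sup>2 * measure \<nu> ?S) = (\<integral>\<^sup>+y. ennreal (a\<^sup>2) * indicator ?S y \<partial>\<nu>)"
    by (simp add: nn_integral_cmult_indicator \<nu>.emeasure_eq_measure ennreal_mult)
  also have "\<dots> \<le> sq_risk \<nu> Q q (map x [0..<l])"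
    unfolding sq_risk_def
  proof (intro nn_integral_mono)
    fix y
    have "ennreal (a\<^sup>2) \<le> ennreal ((Q (map x [0..<l]) (fst y) - q (fst y))\<^sup>2)" if "y \<in> ?S"
      using that \<open>0 < a\<close> by (intro ennreal_leI abs_le_square_iff[THEN iffD1]) auto
    then show "ennreal (a\<^sup>2) * indicator ?S y \<le> (case y of (s, r) \<Rightarrow> ennreal ((Q (map x [0..<l]) s - q s)\<^sup>2))"
      by (auto split: split_indicator simp: split_beta)
  qed
  also note risk
  finally have "a\<^sup>2 * measure \<nu> ?S \<le> \<kappa>" using assms by simp
  then show ?thesis using assms by (simp add: field_simps)
qed

section \<open>Threshold control for a fixed split\<close>

lemma length_filter_map_upt:
  "real (length (filter P (map f (map x [l..<l + m])))) = (\<Sum>j\<in>{l..<l + m}. of_bool (P (f (x j))))"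
  by (induction m) (auto simp: atLeastLessThanSuc)

text \<open>A deterministic count. The rank \<open>m - k\<close> lies within \<open>m * t\<close> of
  \<open>m * (1 - \<epsilon>)\<close>. More scores than the largest such rank are at most a, so the
  ranked score is at most a; fewer than the smallest such rank are below -a, so it is at least -a.
  In particular the infinite default value is excluded.\<close>

lemma calib_threshold_abs_le:
  fixes ts :: "real list" and a t \<epsilon> \<delta> :: real
  defines "k \<equiv> calib_index (length ts) \<epsilon> \<delta>" and "m \<equiv> real (length ts)"
  assumes \<delta>: "0 \<le> \<delta>" and k: "(\<epsilon> - t) * m \<le> k" "k \<le> (\<epsilon> + t) * m"
    and upper: "m * (1 - \<epsilon> + t) < length (filter (\<lambda>x. x \<le> a) ts)"
    and lower: "length (filter (\<lambda>x. x < - a) ts) < m * (1 - \<epsilon> - t)"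
  shows "\<bar>calib_threshold \<epsilon> \<delta> ts\<bar> \<le> ereal a"
proof -
  define j where "j = nat (int (length ts) - k)"
  have "k \<in> {-1..int (length ts) - 1}" unfolding k_def by (rule calib_index_range[OF \<delta>])
  then have j: "1 \<le> j" "j \<le> length ts + 1" "real j = m - k"
    by (auto simp: j_def m_def)
  have \<tau>: "calib_threshold \<epsilon> \<delta> ts = order_stat ts j"
    by (simp add: calib_threshold_def j_def k_def)
  have "order_stat ts j \<le> ereal a"
  proof (rule ccontr)
    assume "\<not> order_stat ts j \<le> ereal a"
    then have "length (filter (\<lambda>x. x \<le> a) ts) < j"
      using order_stat_greater[OF j(1,2)] by simp
    then have "real (length (filter (\<lambda>x. x \<le> a) ts)) < real j" by simp
    also have "\<dots> \<le> m * (1 - \<epsilon> + t)" using j k by (simp add: algebra_simps)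
    finally show False using upper by simp
  qed
  moreover have "ereal (- a) \<le> order_stat ts j"
  proof (rule ccontr)
    assume "\<not> ereal (- a) \<le> order_stat ts j"
    then have "j \<le> length (filter (\<lambda>x. x < - a) ts)"
      using order_stat_less[OF j(1)] by (simp del: uminus_ereal.simps)
    then have "real j \<le> length (filter (\<lambda>x. x < - a) ts)" by simp
    moreover have "m * (1 - \<epsilon> - t) \<le> real j" using j k by (simp add: algebra_simps)
    ultimately show False using lower by simp
  qed
  ultimately show ?thesis unfolding \<tau> by (cases "order_stat ts j") auto
qed

text \<open>Outside E and E', \<open>T x \<le> b\<close> forces \<open>T' x \<le> 2 * b\<close>, and
  \<open>T' x < - a\<close> forces \<open>T x < - b\<close>: one b is the level at which T is
  examined, the other is the perturbation. The rest is a union bound.\<close>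

lemma perturbed_score_margin:
  fixes a b p t :: real
  assumes "prob_space \<nu>"
    and [measurable]: "T \<in> borel_measurable \<nu>" "T' \<in> borel_measurable \<nu>"
      "Measurable.pred \<nu> E" "Measurable.pred \<nu> E'"
    and close: "\<And>x. x \<in> space \<nu> \<Longrightarrow> \<not> E x \<Longrightarrow> \<not> E' x \<Longrightarrow> \<bar>T' x - T x\<bar> \<le> b"
    and E: "measure \<nu> {x \<in> space \<nu>. E x} \<le> t" "measure \<nu> {x \<in> space \<nu>. E' x} \<le> t"
    and ab: "2 * b \<le> a"
    and up: "p + 4 * t \<le> measure \<nu> {x \<in> space \<nu>. T x \<le> b}"
    and lo: "measure \<nu> {x \<in> space \<nu>. T x < - b} \<le> p - 4 * t"
  shows "p + 2 * t \<le> measure \<nu> {x \<in> space \<nu>. T' x \<le> a}"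
    and "measure \<nu> {x \<in> space \<nu>. T' x < - a} \<le> p - 2 * t"
proof -
  interpret prob_space \<nu> by fact
  let ?E = "{x \<in> space \<nu>. E x} \<union> {x \<in> space \<nu>. E' x}"
  have PE: "prob ?E \<le> 2 * t"
    using measure_Un_le[of "{x \<in> space \<nu>. E x}" \<nu> "{x \<in> space \<nu>. E' x}"] E by simp
  have "prob {x \<in> space \<nu>. T x \<le> b} \<le> prob ({x \<in> space \<nu>. T' x \<le> a} \<union> ?E)"
  proof (intro finite_measure_mono subsetI)
    fix x assume x: "x \<in> {x \<in> space \<nu>. T x \<le> b}"
    show "x \<in> {x \<in> space \<nu>. T' x \<le> a} \<union> ?E"
      using x close[of x] ab by (cases "E x \<or> E' x") auto
  qed measurable
  also have "\<dots> \<le> prob {x \<in> space \<nu>. T' x \<le> a} + prob ?E"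
    by (intro measure_Un_le) measurable
  finally show "p + 2 * t \<le> prob {x \<in> space \<nu>. T' x \<le> a}" using up PE by simp
  have "prob {x \<in> space \<nu>. T' x < - a} \<le> prob ({x \<in> space \<nu>. T x < - b} \<union> ?E)"
  proof (intro finite_measure_mono subsetI)
    fix x assume x: "x \<in> {x \<in> space \<nu>. T' x < - a}"
    show "x \<in> {x \<in> space \<nu>. T x < - b} \<union> ?E"
      using x close[of x] ab by (cases "E x \<or> E' x") auto
  qed measurable
  also have "\<dots> \<le> prob {x \<in> space \<nu>. T x < - b} + prob ?E"
    by (intro measure_Un_le) measurable
  finally show "prob {x \<in> space \<nu>. T' x < - a} \<le> p - 2 * t" using lo PE by simp
qed

text \<open>
  Of the margin \<open>4 * t\<close>, the estimation error of the scores costs \<open>2 * t\<close>, and the deviations of the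
  calibration index and of the calibration counts cost \<open>t\<close> each. The exceptional set collects, for each
  of the two quantile estimates, bad training sets and bad test contexts, and for each side of 0
  a bad calibration count; every one of these six has probability at most \<open>r\<close>.
\<close>

lemma conformal_core_fixed_size:
  fixes \<nu> :: "('s \<times> real) measure" and a b t r \<epsilon> \<delta> \<eta> \<rho> :: real
  assumes "prob_space \<nu>"
    and Q: "measurable_algorithm PS Qlo" "measurable_algorithm PS Qup"
    and \<nu>[measurable_cong]: "sets \<nu> = sets (PS \<Otimes>\<^sub>M borel)"
    and q[measurable]: "qlo \<in> borel_measurable PS" "qup \<in> borel_measurable PS"
    and \<delta>: "0 \<le> \<delta>"
    and cons: "consistent_at \<nu> Qlo qlo l \<eta> \<rho>" "consistent_at \<nu> Qup qup l \<eta> \<rho>"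
    and b: "0 < b" "2 * b \<le> a" and t: "0 \<le> t" and m: "0 < m"
    and \<eta>: "\<bar>\<eta>\<bar> / 2 / b\<^sup>2 \<le> t" "\<bar>\<eta>\<bar> / 2 / b\<^sup>2 \<le> r" and \<rho>: "\<rho> / 2 \<le> r" and r: "exp (- 2 * real m * t\<^sup>2) \<le> r"
    and up: "1 - \<epsilon> + 4 * t \<le> measure \<nu> {x \<in> space \<nu>. score qlo qup x \<le> b}"
    and lo: "measure \<nu> {x \<in> space \<nu>. score qlo qup x < - b} \<le> 1 - \<epsilon> - 4 * t"
    and k: "(\<epsilon> - t) * real m \<le> calib_index m \<epsilon> \<delta>" "calib_index m \<epsilon> \<delta> \<le> (\<epsilon> + t) * real m"
  shows "\<exists>G\<in>sets ((\<Pi>\<^sub>M i\<in>{..<l + m}. \<nu>) \<Otimes>\<^sub>M \<nu>).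
    emeasure ((\<Pi>\<^sub>M i\<in>{..<l + m}. \<nu>) \<Otimes>\<^sub>M \<nu>) G \<le> ennreal (6 * r) \<and>
    (\<forall>x\<in>space (\<Pi>\<^sub>M i\<in>{..<l + m}. \<nu>). \<forall>y\<in>space \<nu>. (x, y) \<notin> G \<longrightarrow>
       \<bar>Qlo (map x [0..<l]) (fst y) - qlo (fst y)\<bar> \<le> a \<and> \<bar>Qup (map x [0..<l]) (fst y) - qup (fst y)\<bar> \<le> a \<and>
       \<bar>calib_threshold \<epsilon> \<delta> (map (score (Qlo (map x [0..<l])) (Qup (map x [0..<l]))) (map x [l..<l + m]))\<bar> \<le> ereal a)"
proof -
  interpret \<nu>: prob_space \<nu> by fact
  interpret product_prob_space "\<lambda>_::nat. \<nu>" ..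
  let ?P = "\<Pi>\<^sub>M i\<in>{..<l + m}. \<nu>" and ?P1 = "\<Pi>\<^sub>M i\<in>{..<l}. \<nu>" and ?P2 = "\<Pi>\<^sub>M i\<in>{l..<l + m}. \<nu>"
  interpret P1: prob_space ?P1 by (intro prob_space_PiM \<nu>.prob_space_axioms)
  interpret P2: prob_space ?P2 by (intro prob_space_PiM \<nu>.prob_space_axioms)
  have r0: "0 \<le> r" using r exp_gt_zero[of "- 2 * real m * t\<^sup>2"] by linarith
  define good where "good xs \<longleftrightarrow> sq_risk \<nu> Qlo qlo xs \<le> ennreal (\<eta> / 2) \<and> sq_risk \<nu> Qup qup xs \<le> ennreal (\<eta> / 2)" for xs
  define Elo where "Elo xs y \<longleftrightarrow> b < \<bar>Qlo xs (fst y) - qlo (fst y)\<bar>" for xs and y :: "'s \<times> real"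
  define Eup where "Eup xs y \<longleftrightarrow> b < \<bar>Qup xs (fst y) - qup (fst y)\<bar>" for xs and y :: "'s \<times> real"
  define h where "h xs = score (Qlo xs) (Qup xs)" for xs
  \<comment> \<open>Only the coordinates from l on are read, so at a fixed training list this is an
    event of the calibration block alone.\<close>
  define bad where "bad xs z \<longleftrightarrow>
      (\<Sum>j\<in>{l..<l + m}. of_bool (h xs (z j) \<le> a)) \<le> real m * (1 - \<epsilon> + t) \<or>
      real m * (1 - \<epsilon> - t) \<le> (\<Sum>j\<in>{l..<l + m}. of_bool (h xs (z j) < - a))" for xs z
  \<comment> \<open>Being an implication, the condition puts every sample whose training part is not
    \<open>good\<close> into G.\<close>
  define G where "G = {w \<in> space (?P \<Otimes>\<^sub>M \<nu>).
      good (map (fst w) [0..<l]) \<longrightarrow> Elo (map (fst w) [0..<l]) (snd w) \<or> Eup (map (fst w) [0..<l]) (snd w) \<or>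
        bad (map (fst w) [0..<l]) (fst w)}"

  have sub: "{..<l} \<subseteq> {..<l + m}" by auto
  note QM = measurable_algorithm_compose[OF Q(1) \<nu>] measurable_algorithm_compose[OF Q(2) \<nu>]
  \<comment> \<open>Needed in two situations: with the whole sample and one of its own calibration
    coordinates, and with the training part frozen at a constant.\<close>
  have h_meas: "(\<lambda>w. h (map (f w) [0..<l]) (g w)) \<in> borel_measurable N"
    if "f \<in> N \<rightarrow>\<^sub>M (\<Pi>\<^sub>M i\<in>I. \<nu>)" "{..<l} \<subseteq> I" and g[measurable]: "g \<in> N \<rightarrow>\<^sub>M \<nu>" for N f I and g :: "'z \<Rightarrow> 's \<times> real"
  proof -
    have [measurable]: "(\<lambda>w. fst (g w)) \<in> N \<rightarrow>\<^sub>M PS" "(\<lambda>w. snd (g w)) \<in> borel_measurable N"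
      using measurable_compose[OF g, of fst PS] measurable_compose[OF g, of snd borel]
      by (simp_all add: measurable_cong_sets[OF \<nu> refl])
    note [measurable] = QM[OF that(2) that(1), of "\<lambda>w. fst (g w)"]
    show ?thesis unfolding h_def score_def split_beta by measurable
  qed
  have Q_test[measurable]: "(\<lambda>w. Qlo (map (fst w) [0..<l]) (fst (snd w))) \<in> borel_measurable (?P \<Otimes>\<^sub>M \<nu>)"
     "(\<lambda>w. Qup (map (fst w) [0..<l]) (fst (snd w))) \<in> borel_measurable (?P \<Otimes>\<^sub>M \<nu>)"
    by (rule QM[OF sub]; measurable)+
  have [measurable]: "Measurable.pred ?P (\<lambda>x. good (map x [0..<l]))"
    using borel_measurable_sq_risk[OF assms(1) Q(1) \<nu> sub q(1)] borel_measurable_sq_risk[OF assms(1) Q(2) \<nu> sub q(2)]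
    unfolding good_def by measurable
  have [measurable]: "(\<lambda>x. h (map x [0..<l]) (x j)) \<in> borel_measurable ?P" if "j \<in> {l..<l + m}" for j
    using that by (intro h_meas[OF _ sub]) auto
  have G[measurable]: "G \<in> sets (?P \<Otimes>\<^sub>M \<nu>)"
    unfolding G_def Elo_def Eup_def bad_def by measurable

  \<comment> \<open>With the training part frozen at u the score is one fixed function, so the
    calibration scores are i.i.d. and Hoeffding's inequality applies. The \<open>4 * r\<close>
    covers two test events and two count events; the indicator absorbs training samples that are not
    \<open>good\<close>.\<close>
  have fixed: "(\<integral>\<^sup>+z. \<integral>\<^sup>+y. indicator G (merge {..<l} {l..<l + m} (u, z), y) \<partial>\<nu> \<partial>?P2) \<le>
      indicator {u \<in> space ?P1. \<not> good (map u [0..<l])} u + ennreal (4 * r)"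
    if u: "u \<in> space ?P1" for u
  proof (cases "good (map u [0..<l])")
    case False
    have "(\<integral>\<^sup>+z. \<integral>\<^sup>+y. indicator G (merge {..<l} {l..<l + m} (u, z), y) \<partial>\<nu> \<partial>?P2) \<le> (\<integral>\<^sup>+z. \<integral>\<^sup>+y. 1 \<partial>\<nu> \<partial>?P2)"
      by (intro nn_integral_mono) (auto split: split_indicator)
    also have "\<dots> = 1" by (simp add: P2.emeasure_space_1 \<nu>.emeasure_space_1)
    finally show ?thesis using False u by (simp add: add_increasing2)
  next
    case True
    let ?xs = "map u [0..<l]"
    have [measurable]: "h ?xs \<in> borel_measurable \<nu>"
      using h_meas[OF measurable_const[OF u], of "\<lambda>y. y" \<nu>] by simp
    have [measurable]: "(\<lambda>y. Qlo ?xs (fst y)) \<in> borel_measurable \<nu>" "(\<lambda>y. Qup ?xs (fst y)) \<in> borel_measurable \<nu>"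
      using QM[OF subset_refl measurable_const[OF u], of fst \<nu>] by auto
    have [measurable]: "Measurable.pred \<nu> (Elo ?xs)" "Measurable.pred \<nu> (Eup ?xs)"
      unfolding Elo_def Eup_def by measurable
    have [measurable]: "score qlo qup \<in> borel_measurable \<nu>" unfolding score_def by measurable
    \<comment> \<open>\<eta> may be negative, in which case \<open>ennreal\<close> sends it to 0;
      the absolute value gives a nonnegative real bound in either case.\<close>
    let ?\<kappa> = "\<bar>\<eta>\<bar> / 2"
    have le: "ennreal (\<eta> / 2) \<le> ennreal ?\<kappa>" by (intro ennreal_leI) simp
    have risk: "sq_risk \<nu> Qlo qlo ?xs \<le> ennreal ?\<kappa>" "sq_risk \<nu> Qup qup ?xs \<le> ennreal ?\<kappa>"
      by (rule order_trans[OF _ le], use True in \<open>simp add: good_def\<close>)+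
    have E: "\<nu>.prob {y \<in> space \<nu>. Elo ?xs y} \<le> ?\<kappa> / b\<^sup>2" "\<nu>.prob {y \<in> space \<nu>. Eup ?xs y} \<le> ?\<kappa> / b\<^sup>2"
      unfolding Elo_def Eup_def
      using sq_risk_Markov[OF assms(1) Q(1) \<nu> q(1) u risk(1) _ b(1)] sq_risk_Markov[OF assms(1) Q(2) \<nu> q(2) u risk(2) _ b(1)]
      by auto
    have close: "\<bar>h ?xs y - score qlo qup y\<bar> \<le> b" if "\<not> Elo ?xs y" "\<not> Eup ?xs y" for y
      using that score_perturbation[of "Qlo ?xs" "fst y" qlo b "Qup ?xs" qup "snd y"]
      by (simp add: Elo_def Eup_def h_def)
    have margin: "1 - \<epsilon> + 2 * t \<le> \<nu>.prob {y \<in> space \<nu>. h ?xs y \<le> a}"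
        "\<nu>.prob {y \<in> space \<nu>. h ?xs y < - a} \<le> 1 - \<epsilon> - 2 * t"
      using perturbed_score_margin[where T = "score qlo qup" and T' = "h ?xs" and E = "Elo ?xs" and E' = "Eup ?xs"
          and t = t and a = a and b = b and p = "1 - \<epsilon>", OF assms(1)] close E \<eta> b up lo by auto
    let ?S1 = "{z \<in> space ?P2. (\<Sum>j\<in>{l..<l + m}. of_bool (h ?xs (z j) \<le> a)) \<le>
        real m * (\<nu>.prob {y \<in> space \<nu>. h ?xs y \<le> a} - t)}"
    let ?S2 = "{z \<in> space ?P2. real m * (\<nu>.prob {y \<in> space \<nu>. h ?xs y < - a} + t) \<le>
        (\<Sum>j\<in>{l..<l + m}. of_bool (h ?xs (z j) < - a))}"
    have S: "P2.prob ?S1 \<le> r" "P2.prob ?S2 \<le> r"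
      using Hoeffding_PiM_count(1)[OF assms(1), of "{l..<l + m}" t "\<lambda>y. h ?xs y \<le> a"]
        Hoeffding_PiM_count(2)[OF assms(1), of "{l..<l + m}" t "\<lambda>y. h ?xs y < - a"] m t r by auto
    \<comment> \<open>Each summand depends on y alone or on z alone, so the double integral
      separates into four probabilities.\<close>
    have pw: "indicator G (merge {..<l} {l..<l + m} (u, z), y) \<le>
        indicator {y \<in> space \<nu>. Elo ?xs y} y + indicator {y \<in> space \<nu>. Eup ?xs y} y +
        (indicator ?S1 z + indicator ?S2 z :: ennreal)" if z: "z \<in> space ?P2" and y: "y \<in> space \<nu>" for z y
    proof -
      have xs: "map (merge {..<l} {l..<l + m} (u, z)) [0..<l] = ?xs" by (auto simp: merge_def)
      have "bad ?xs (merge {..<l} {l..<l + m} (u, z)) \<longleftrightarrow> bad ?xs z" by (simp add: bad_def merge_def)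
      \<comment> \<open>Half of the remaining margin \<open>2 * t\<close> is spent here: the count
        threshold in terms of \<epsilon> is traded for one at distance t from the true probability
        of the score event, the form that Hoeffding's inequality provides.\<close>
      moreover have "z \<in> ?S1 \<or> z \<in> ?S2" if "bad ?xs z"
        using that unfolding bad_def
      proof
        assume *: "(\<Sum>j\<in>{l..<l + m}. of_bool (h ?xs (z j) \<le> a)) \<le> real m * (1 - \<epsilon> + t)"
        also have "\<dots> \<le> real m * (\<nu>.prob {y \<in> space \<nu>. h ?xs y \<le> a} - t)"
          using margin(1) by (intro mult_left_mono) auto
        finally show ?thesis using z by simp
      next
        assume *: "real m * (1 - \<epsilon> - t) \<le> (\<Sum>j\<in>{l..<l + m}. of_bool (h ?xs (z j) < - a))"
        have "real m * (\<nu>.prob {y \<in> space \<nu>. h ?xs y < - a} + t) \<le> real m * (1 - \<epsilon> - t)"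
          using margin(2) by (intro mult_left_mono) auto
        also note *
        finally show ?thesis using z by simp
      qed
      ultimately have "Elo ?xs y \<or> Eup ?xs y \<or> z \<in> ?S1 \<or> z \<in> ?S2"
        if "(merge {..<l} {l..<l + m} (u, z), y) \<in> G"
        using that True by (auto simp: G_def xs)
      then show ?thesis using y by (auto split: split_indicator)
    qed
    have "(\<integral>\<^sup>+z. \<integral>\<^sup>+y. indicator G (merge {..<l} {l..<l + m} (u, z), y) \<partial>\<nu> \<partial>?P2) \<le>
       (\<integral>\<^sup>+z. \<integral>\<^sup>+y. indicator {y \<in> space \<nu>. Elo ?xs y} y + indicator {y \<in> space \<nu>. Eup ?xs y} y +
          (indicator ?S1 z + indicator ?S2 z) \<partial>\<nu> \<partial>?P2)"
      by (intro nn_integral_mono pw)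
    also have "\<dots> = (\<integral>\<^sup>+z. ennreal (\<nu>.prob {y \<in> space \<nu>. Elo ?xs y} + \<nu>.prob {y \<in> space \<nu>. Eup ?xs y}) +
          (indicator ?S1 z + indicator ?S2 z) \<partial>?P2)"
    proof (intro nn_integral_cong)
      fix z
      have "(\<integral>\<^sup>+y. indicator {y \<in> space \<nu>. Elo ?xs y} y + indicator {y \<in> space \<nu>. Eup ?xs y} y + c \<partial>\<nu>) =
          ennreal (\<nu>.prob {y \<in> space \<nu>. Elo ?xs y} + \<nu>.prob {y \<in> space \<nu>. Eup ?xs y}) + c" for c :: ennreal
      proof -
        have [measurable]: "{y \<in> space \<nu>. Elo ?xs y} \<in> sets \<nu>" "{y \<in> space \<nu>. Eup ?xs y} \<in> sets \<nu>"
          by measurable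
        then show ?thesis
          by (simp only: nn_integral_add borel_measurable_indicator borel_measurable_const borel_measurable_add
              nn_integral_indicator nn_integral_const \<nu>.prob_space ennreal_1 mult_1_right \<nu>.emeasure_eq_measure
              ennreal_plus measure_nonneg)
      qed
      then show "(\<integral>\<^sup>+y. indicator {y \<in> space \<nu>. Elo ?xs y} y + indicator {y \<in> space \<nu>. Eup ?xs y} y +
          (indicator ?S1 z + indicator ?S2 z) \<partial>\<nu>) =
          ennreal (\<nu>.prob {y \<in> space \<nu>. Elo ?xs y} + \<nu>.prob {y \<in> space \<nu>. Eup ?xs y}) +
          (indicator ?S1 z + indicator ?S2 z)" .
    qed
    also have "\<dots> = ennreal (\<nu>.prob {y \<in> space \<nu>. Elo ?xs y} + \<nu>.prob {y \<in> space \<nu>. Eup ?xs y}) +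
        ennreal (P2.prob ?S1 + P2.prob ?S2)"
    proof -
      have "?S1 \<in> sets ?P2" "?S2 \<in> sets ?P2" by measurable
      then show ?thesis
        by (simp only: nn_integral_add borel_measurable_indicator borel_measurable_const borel_measurable_add
            nn_integral_indicator nn_integral_const P2.prob_space ennreal_1 mult_1_right P2.emeasure_eq_measure
            ennreal_plus measure_nonneg)
    qed
    also have "\<dots> = ennreal (\<nu>.prob {y \<in> space \<nu>. Elo ?xs y} + \<nu>.prob {y \<in> space \<nu>. Eup ?xs y} +
        (P2.prob ?S1 + P2.prob ?S2))"
      by (intro ennreal_plus[symmetric] add_nonneg_nonneg measure_nonneg)
    also have "\<dots> \<le> ennreal (4 * r)"
      using E S \<eta> by (intro ennreal_leI) linarith
    finally show ?thesis using True by simp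
  qed
  have "emeasure (?P \<Otimes>\<^sub>M \<nu>) G = (\<integral>\<^sup>+x. \<integral>\<^sup>+y. indicator G (x, y) \<partial>\<nu> \<partial>?P)"
    by (rule \<nu>.emeasure_pair_measure[OF G])
  also have "\<dots> = (\<integral>\<^sup>+u. \<integral>\<^sup>+z. \<integral>\<^sup>+y. indicator G (merge {..<l} {l..<l + m} (u, z), y) \<partial>\<nu> \<partial>?P2 \<partial>?P1)"
  proof -
    have un: "{..<l} \<union> {l..<l + m} = {..<l + m}" and int: "{..<l} \<inter> {l..<l + m} = {}" by auto
    have "(\<lambda>x. \<integral>\<^sup>+y. indicator G (x, y) \<partial>\<nu>) \<in> borel_measurable ?P" by measurable
    then show ?thesis
      using product_nn_integral_fold[of "{..<l}" "{l..<l + m}" "\<lambda>x. \<integral>\<^sup>+y. indicator G (x, y) \<partial>\<nu>", OF int]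
      unfolding un by simp
  qed
  also have "\<dots> \<le> (\<integral>\<^sup>+u. indicator {u \<in> space ?P1. \<not> good (map u [0..<l])} u + ennreal (4 * r) \<partial>?P1)"
    by (intro nn_integral_mono fixed)
  also have "\<dots> \<le> ennreal (6 * r)"
  proof -
    note [measurable] = borel_measurable_sq_risk[OF assms(1) Q(1) \<nu> subset_refl q(1)]
      borel_measurable_sq_risk[OF assms(1) Q(2) \<nu> subset_refl q(2)]
    let ?Blo = "{x \<in> space ?P1. \<not> sq_risk \<nu> Qlo qlo (map x [0..<l]) \<le> ennreal (\<eta> / 2)}"
    let ?Bup = "{x \<in> space ?P1. \<not> sq_risk \<nu> Qup qup (map x [0..<l]) \<le> ennreal (\<eta> / 2)}"
    have "{u \<in> space ?P1. \<not> good (map u [0..<l])} = ?Blo \<union> ?Bup"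
      by (auto simp: good_def)
    moreover have "P1.prob (?Blo \<union> ?Bup) \<le> P1.prob ?Blo + P1.prob ?Bup"
      by (intro measure_Un_le) measurable
    moreover have "P1.prob ?Blo \<le> r" "P1.prob ?Bup \<le> r"
      using consistent_at_sq_risk[OF assms(1) Q(1) \<nu> q(1) cons(1)]
        consistent_at_sq_risk[OF assms(1) Q(2) \<nu> q(2) cons(2)] \<rho> by linarith+
    ultimately have "P1.prob {u \<in> space ?P1. \<not> good (map u [0..<l])} \<le> 2 * r" by simp
    moreover have [measurable]: "{u \<in> space ?P1. \<not> good (map u [0..<l])} \<in> sets ?P1"
      unfolding good_def by measurable
    ultimately show ?thesis using r0
      by (simp add: nn_integral_add P1.emeasure_eq_measure P1.prob_space ennreal_plus[symmetric] del: ennreal_plus)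
  qed
  finally have "emeasure (?P \<Otimes>\<^sub>M \<nu>) G \<le> ennreal (6 * r)" .
  moreover have "\<bar>Qlo (map x [0..<l]) (fst y) - qlo (fst y)\<bar> \<le> a \<and> \<bar>Qup (map x [0..<l]) (fst y) - qup (fst y)\<bar> \<le> a \<and>
       \<bar>calib_threshold \<epsilon> \<delta> (map (score (Qlo (map x [0..<l])) (Qup (map x [0..<l]))) (map x [l..<l + m]))\<bar> \<le> ereal a"
    if x: "x \<in> space ?P" and y: "y \<in> space \<nu>" and nG: "(x, y) \<notin> G" for x y
  proof -
    let ?xs = "map x [0..<l]"
    have "\<not> Elo ?xs y" "\<not> Eup ?xs y" "\<not> bad ?xs x"
      using nG x y by (auto simp: G_def space_pair_measure)
    moreover define ts where "ts = map (h ?xs) (map x [l..<l + m])"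
    have "length ts = m" by (simp add: ts_def)
    moreover have "real (length (filter P ts)) = (\<Sum>j\<in>{l..<l + m}. of_bool (P (h ?xs (x j))))" for P
      unfolding ts_def by (rule length_filter_map_upt)
    ultimately have "\<bar>calib_threshold \<epsilon> \<delta> ts\<bar> \<le> ereal a"
      using k unfolding bad_def by (intro calib_threshold_abs_le[where t = t, OF \<delta>]) auto
    then show ?thesis using b \<open>\<not> Elo ?xs y\<close> \<open>\<not> Eup ?xs y\<close>
      by (auto simp: Elo_def Eup_def h_def ts_def)
  qed
  ultimately show ?thesis using G by blast
qed

text \<open>Chooses the constants so that each of the six error terms is at most
  \<open>r / 6\<close>. One bound L serves every pair l, m above it, because the sizes of the two
  parts are random when the result is applied.\<close>

lemma conformal_core:
  fixes \<nu> :: "('s \<times> real) measure" and a r c t0 \<epsilon> \<delta> :: real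
  assumes "prob_space \<nu>"
    and Q: "measurable_algorithm PS Qlo" "measurable_algorithm PS Qup"
    and \<nu>: "sets \<nu> = sets (PS \<Otimes>\<^sub>M borel)"
    and q: "qlo \<in> borel_measurable PS" "qup \<in> borel_measurable PS"
    and \<epsilon>: "0 < \<epsilon>" "\<epsilon> < 1" and \<delta>: "0 < \<delta>" "\<delta> < 1"
    and \<eta>: "\<eta> \<longlonglongrightarrow> 0" and \<rho>: "\<rho> \<longlonglongrightarrow> 0"
    and cons: "\<forall>\<^sub>F l in sequentially. consistent_at \<nu> Qlo qlo l (\<eta> l) (\<rho> l) \<and> consistent_at \<nu> Qup qup l (\<eta> l) (\<rho> l)"
    and c: "0 < c" and t0: "0 < t0"
    and up: "\<And>t. 0 < t \<Longrightarrow> t \<le> t0 \<Longrightarrow> 1 - \<epsilon> + c * t \<le> measure \<nu> {x \<in> space \<nu>. score qlo qup x \<le> t}"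
    and lo: "\<And>t. 0 < t \<Longrightarrow> t \<le> t0 \<Longrightarrow> measure \<nu> {x \<in> space \<nu>. score qlo qup x < - t} \<le> 1 - \<epsilon> - c * t"
    and a: "0 < a" and r: "0 < r"
  shows "\<exists>L. \<forall>l\<ge>L. \<forall>m\<ge>L. \<exists>G\<in>sets ((\<Pi>\<^sub>M i\<in>{..<l + m}. \<nu>) \<Otimes>\<^sub>M \<nu>).
    emeasure ((\<Pi>\<^sub>M i\<in>{..<l + m}. \<nu>) \<Otimes>\<^sub>M \<nu>) G \<le> ennreal r \<and>
    (\<forall>x\<in>space (\<Pi>\<^sub>M i\<in>{..<l + m}. \<nu>). \<forall>y\<in>space \<nu>. (x, y) \<notin> G \<longrightarrow>
       \<bar>Qlo (map x [0..<l]) (fst y) - qlo (fst y)\<bar> \<le> a \<and> \<bar>Qup (map x [0..<l]) (fst y) - qup (fst y)\<bar> \<le> a \<and>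
       \<bar>calib_threshold \<epsilon> \<delta> (map (score (Qlo (map x [0..<l])) (Qup (map x [0..<l]))) (map x [l..<l + m]))\<bar> \<le> ereal a)"
proof -
  \<comment> \<open>The bound \<open>a / 2\<close> leaves room for the perturbation of the scores
    and t0 is the range of the margin; t is chosen so that the margin \<open>c * b\<close> at level
    b equals \<open>4 * t\<close>.\<close>
  define b where "b = min (a / 2) t0"
  define t where "t = c * b / 4"
  have b: "0 < b" "2 * b \<le> a" "b \<le> t0" using a t0 by (auto simp: b_def)
  have t: "0 < t" using b c by (simp add: t_def)
  have "(\<lambda>l. \<bar>\<eta> l\<bar> / 2 / b\<^sup>2) \<longlonglongrightarrow> \<bar>0\<bar> / 2 / b\<^sup>2"
    using b by (intro tendsto_intros \<eta>) auto
  then have "(\<lambda>l. \<bar>\<eta> l\<bar> / 2 / b\<^sup>2) \<longlonglongrightarrow> 0" by (simp only: abs_zero div_0)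
  from order_tendstoD(2)[OF this t] order_tendstoD(2)[OF this, of "r / 6"]
  have "\<forall>\<^sub>F l in sequentially. \<bar>\<eta> l\<bar> / 2 / b\<^sup>2 < t" "\<forall>\<^sub>F l in sequentially. \<bar>\<eta> l\<bar> / 2 / b\<^sup>2 < r / 6"
    using r by auto
  moreover have "(\<lambda>l. \<rho> l / 2) \<longlonglongrightarrow> 0 / 2" by (intro tendsto_intros \<rho>) auto
  from order_tendstoD(2)[OF this, of "r / 6"] have "\<forall>\<^sub>F l in sequentially. \<rho> l / 2 < r / 6" using r by simp
  ultimately have "\<forall>\<^sub>F l in sequentially. consistent_at \<nu> Qlo qlo l (\<eta> l) (\<rho> l) \<and> consistent_at \<nu> Qup qup l (\<eta> l) (\<rho> l) \<and>
      \<bar>\<eta> l\<bar> / 2 / b\<^sup>2 \<le> t \<and> \<bar>\<eta> l\<bar> / 2 / b\<^sup>2 \<le> r / 6 \<and> \<rho> l / 2 \<le> r / 6"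
    using cons by eventually_elim auto
  then obtain L1 where L1: "\<And>l. l \<ge> L1 \<Longrightarrow> consistent_at \<nu> Qlo qlo l (\<eta> l) (\<rho> l) \<and> consistent_at \<nu> Qup qup l (\<eta> l) (\<rho> l) \<and>
      \<bar>\<eta> l\<bar> / 2 / b\<^sup>2 \<le> t \<and> \<bar>\<eta> l\<bar> / 2 / b\<^sup>2 \<le> r / 6 \<and> \<rho> l / 2 \<le> r / 6"
    by (auto simp: eventually_sequentially)
  have "(\<lambda>m. exp (- 2 * real m * t\<^sup>2)) \<longlonglongrightarrow> 0" using t by real_asymp
  then have "\<forall>\<^sub>F m in sequentially. exp (- 2 * real m * t\<^sup>2) < r / 6"
    using r by (intro order_tendstoD) auto
  then have "\<forall>\<^sub>F m in sequentially. 0 < m \<and> exp (- 2 * real m * t\<^sup>2) \<le> r / 6 \<and>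
      (\<epsilon> - t) * real m \<le> calib_index m \<epsilon> \<delta> \<and> calib_index m \<epsilon> \<delta> \<le> (\<epsilon> + t) * real m"
    using calib_index_asymptotic[OF \<epsilon> \<delta> t] eventually_gt_at_top[of 0] by eventually_elim auto
  then obtain L2 where L2: "\<And>m. m \<ge> L2 \<Longrightarrow> 0 < m \<and> exp (- 2 * real m * t\<^sup>2) \<le> r / 6 \<and>
      (\<epsilon> - t) * real m \<le> calib_index m \<epsilon> \<delta> \<and> calib_index m \<epsilon> \<delta> \<le> (\<epsilon> + t) * real m"
    by (auto simp: eventually_sequentially)
  have margin: "1 - \<epsilon> + 4 * t \<le> measure \<nu> {x \<in> space \<nu>. score qlo qup x \<le> b}"
     "measure \<nu> {x \<in> space \<nu>. score qlo qup x < - b} \<le> 1 - \<epsilon> - 4 * t"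
    using up[of b] lo[of b] b by (auto simp: t_def)
  show ?thesis
  proof (intro exI[of _ "max L1 L2"] allI impI)
    fix l m assume "max L1 L2 \<le> l" "max L1 L2 \<le> m"
    then have l: "L1 \<le> l" and m: "L2 \<le> m" by auto
    show "\<exists>G\<in>sets ((\<Pi>\<^sub>M i\<in>{..<l + m}. \<nu>) \<Otimes>\<^sub>M \<nu>).
    emeasure ((\<Pi>\<^sub>M i\<in>{..<l + m}. \<nu>) \<Otimes>\<^sub>M \<nu>) G \<le> ennreal r \<and>
    (\<forall>x\<in>space (\<Pi>\<^sub>M i\<in>{..<l + m}. \<nu>). \<forall>y\<in>space \<nu>. (x, y) \<notin> G \<longrightarrow>
       \<bar>Qlo (map x [0..<l]) (fst y) - qlo (fst y)\<bar> \<le> a \<and> \<bar>Qup (map x [0..<l]) (fst y) - qup (fst y)\<bar> \<le> a \<and>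
       \<bar>calib_threshold \<epsilon> \<delta> (map (score (Qlo (map x [0..<l])) (Qup (map x [0..<l]))) (map x [l..<l + m]))\<bar> \<le> ereal a)"
      using conformal_core_fixed_size[OF assms(1) Q \<nu> q, of \<delta> l "\<eta> l" "\<rho> l" b a t m "r / 6" \<epsilon>]
        L1[OF l] L2[OF m] margin b t \<delta> by simp
  qed
qed

section \<open>Laws of the contextual bandit\<close>

locale contextual_bandit = prob_space PS
  for PS :: "'s measure" +
  fixes da :: "'a measure" and PR :: "'s \<times> 'a \<Rightarrow> real measure"
  assumes PR: "PR \<in> PS \<Otimes>\<^sub>M da \<rightarrow>\<^sub>M prob_algebra borel"
begin

lemma policy_kernel:
  assumes "policy PS da \<pi>"
  shows "(\<lambda>s. density da (\<lambda>a. ennreal (\<pi> s a))) \<in> PS \<rightarrow>\<^sub>M prob_algebra da"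
  using assms by (simp add: policy_def)

lemma borel_measurable_policy:
  assumes "policy PS da \<pi>"
  shows "(\<lambda>x. \<pi> (fst x) (snd x)) \<in> borel_measurable (PS \<Otimes>\<^sub>M da)"
  using assms by (simp add: policy_def case_prod_unfold)

lemma borel_measurable_policy_section:
  assumes "policy PS da \<pi>" "s \<in> space PS"
  shows "\<pi> s \<in> borel_measurable da"
  using measurable_compose[OF measurable_Pair1'[OF assms(2)] borel_measurable_policy[OF assms(1)]]
  by simp

lemma PR_section:
  assumes "s \<in> space PS"
  shows "(\<lambda>a. PR (s, a)) \<in> da \<rightarrow>\<^sub>M prob_algebra borel"
  using measurable_compose[OF measurable_Pair1'[OF assms] PR] .

lemma borel_measurable_nn_integral_PR:
  assumes "s \<in> space PS" "f \<in> borel_measurable borel"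
  shows "(\<lambda>a. \<integral>\<^sup>+r. f r \<partial>PR (s, a)) \<in> borel_measurable da"
  by (rule measurable_compose[OF measurable_prob_algebraD[OF PR_section[OF assms(1)]]
        nn_integral_measurable_subprob_algebra[OF assms(2)]])

lemma bandit_kernel:
  assumes "\<phi> \<in> PS \<Otimes>\<^sub>M da \<Otimes>\<^sub>M borel \<rightarrow>\<^sub>M R"
  shows "(\<lambda>(s, a). PR (s, a) \<bind> (\<lambda>r. return R (\<phi> (s, a, r)))) \<in> PS \<Otimes>\<^sub>M da \<rightarrow>\<^sub>M prob_algebra R"
proof -
  have "(\<lambda>(x, r). return R (\<phi> (fst x, snd x, r))) \<in> (PS \<Otimes>\<^sub>M da) \<Otimes>\<^sub>M borel \<rightarrow>\<^sub>M prob_algebra R"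
    using assms by (auto intro!: measurable_compose[OF _ measurable_return_prob_space] simp: split_beta')
  from measurable_bind_prob_space2[OF PR this] show ?thesis by (simp add: case_prod_unfold)
qed

lemma bandit_kernel_fst:
  assumes "policy PS da \<pi>" "\<phi> \<in> PS \<Otimes>\<^sub>M da \<Otimes>\<^sub>M borel \<rightarrow>\<^sub>M R"
  shows "(\<lambda>s. density da (\<lambda>a. ennreal (\<pi> s a)) \<bind> (\<lambda>a. PR (s, a) \<bind> (\<lambda>r. return R (\<phi> (s, a, r)))))
    \<in> PS \<rightarrow>\<^sub>M prob_algebra R"
  by (rule measurable_bind_prob_space2[OF policy_kernel[OF assms(1)] bandit_kernel[OF assms(2)]])

text \<open>The image under \<phi> of the law of context, action and reward. The data law and the
  target law are both instances, so one integral formula serves them.\<close>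

definition bandit_law :: "('s \<Rightarrow> 'a \<Rightarrow> real) \<Rightarrow> 'c measure \<Rightarrow> ('s \<times> 'a \<times> real \<Rightarrow> 'c) \<Rightarrow> 'c measure" where
  "bandit_law \<pi> R \<phi> =
     PS \<bind> (\<lambda>s. density da (\<lambda>a. ennreal (\<pi> s a)) \<bind> (\<lambda>a. PR (s, a) \<bind> (\<lambda>r. return R (\<phi> (s, a, r)))))"

lemma
  assumes "policy PS da \<pi>" "\<phi> \<in> PS \<Otimes>\<^sub>M da \<Otimes>\<^sub>M borel \<rightarrow>\<^sub>M R"
  shows prob_space_bandit_law: "prob_space (bandit_law \<pi> R \<phi>)"
    and sets_bandit_law: "sets (bandit_law \<pi> R \<phi>) = sets R"
proof -
  have PS: "PS \<in> space (prob_algebra PS)"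
    by (simp add: space_prob_algebra prob_space_axioms)
  note K = bandit_kernel_fst[OF assms]
  show "prob_space (bandit_law \<pi> R \<phi>)"
    unfolding bandit_law_def by (rule prob_space_bind'[OF PS K])
  show "sets (bandit_law \<pi> R \<phi>) = sets R"
    unfolding bandit_law_def
    by (rule sets_bind[OF sets_kernel[OF measurable_prob_algebraD[OF K]] not_empty])
qed

text \<open>Turns the nested binds into an iterated integral in which the policy is a density factor
  against \<open>da\<close>; in this form the weight can cancel the behavior density
  pointwise.\<close>

lemma nn_integral_bandit_law:
  assumes \<pi>: "policy PS da \<pi>" and \<phi>: "\<phi> \<in> PS \<Otimes>\<^sub>M da \<Otimes>\<^sub>M borel \<rightarrow>\<^sub>M R"
    and f: "f \<in> borel_measurable R"
  shows "(\<integral>\<^sup>+x. f x \<partial>bandit_law \<pi> R \<phi>) =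
    (\<integral>\<^sup>+s. \<integral>\<^sup>+a. ennreal (\<pi> s a) * (\<integral>\<^sup>+r. f (\<phi> (s, a, r)) \<partial>PR (s, a)) \<partial>da \<partial>PS)"
proof -
  note [measurable] = borel_measurable_policy[OF \<pi>] \<phi> f measurable_prob_algebraD[OF PR]
  have inner: "(\<integral>\<^sup>+x. f x \<partial>(PR (s, a) \<bind> (\<lambda>r. return R (\<phi> (s, a, r))))) = (\<integral>\<^sup>+r. f (\<phi> (s, a, r)) \<partial>PR (s, a))"
    if sa[measurable]: "s \<in> space PS" "a \<in> space da" for s a
  proof -
    have sets_PR[measurable_cong]: "sets (PR (s, a)) = sets borel"
      using measurable_space[OF PR, of "(s, a)"] that by (auto simp: space_prob_algebra space_pair_measure)
    have "(\<lambda>r. \<phi> (s, a, r)) \<in> borel \<rightarrow>\<^sub>M R" by measurable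
    then have m: "(\<lambda>r. \<phi> (s, a, r)) \<in> PR (s, a) \<rightarrow>\<^sub>M R"
      by (simp add: measurable_cong_sets[OF sets_PR refl])
    have "(\<integral>\<^sup>+x. f x \<partial>(PR (s, a) \<bind> (\<lambda>r. return R (\<phi> (s, a, r))))) =
        (\<integral>\<^sup>+r. \<integral>\<^sup>+x. f x \<partial>return R (\<phi> (s, a, r)) \<partial>PR (s, a))"
      using m by (intro nn_integral_bind[OF f]) (auto intro!: measurable_compose[OF _ return_measurable])
    also have "\<dots> = (\<integral>\<^sup>+r. f (\<phi> (s, a, r)) \<partial>PR (s, a))"
      using measurable_space[OF m] f sets_eq_imp_space_eq[OF sets_PR]
      by (intro nn_integral_cong nn_integral_return) auto
    finally show ?thesis .
  qed
  have "(\<integral>\<^sup>+x. f x \<partial>bandit_law \<pi> R \<phi>) =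
    (\<integral>\<^sup>+s. \<integral>\<^sup>+x. f x \<partial>(density da (\<lambda>a. ennreal (\<pi> s a)) \<bind> (\<lambda>a. PR (s, a) \<bind> (\<lambda>r. return R (\<phi> (s, a, r))))) \<partial>PS)"
    unfolding bandit_law_def
    by (rule nn_integral_bind[OF f measurable_prob_algebraD[OF bandit_kernel_fst[OF \<pi> \<phi>]]])
  also have "\<dots> = (\<integral>\<^sup>+s. \<integral>\<^sup>+a. ennreal (\<pi> s a) * (\<integral>\<^sup>+r. f (\<phi> (s, a, r)) \<partial>PR (s, a)) \<partial>da \<partial>PS)"
  proof (intro nn_integral_cong)
    fix s assume s[measurable]: "s \<in> space PS"
    have K: "(\<lambda>a. PR (s, a) \<bind> (\<lambda>r. return R (\<phi> (s, a, r)))) \<in> da \<rightarrow>\<^sub>M subprob_algebra R"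
      using measurable_compose[OF measurable_Pair1'[OF s, of da] measurable_prob_algebraD[OF bandit_kernel[OF \<phi>]]]
      by simp
    have "(\<lambda>a. \<integral>\<^sup>+x. f x \<partial>(PR (s, a) \<bind> (\<lambda>r. return R (\<phi> (s, a, r))))) \<in> borel_measurable da"
      by (rule measurable_compose[OF K nn_integral_measurable_subprob_algebra[OF f]])
    moreover have "(\<integral>\<^sup>+x. f x \<partial>(density da (\<lambda>a. ennreal (\<pi> s a)) \<bind> (\<lambda>a. PR (s, a) \<bind> (\<lambda>r. return R (\<phi> (s, a, r)))))) =
      (\<integral>\<^sup>+a. \<integral>\<^sup>+x. f x \<partial>(PR (s, a) \<bind> (\<lambda>r. return R (\<phi> (s, a, r)))) \<partial>density da (\<lambda>a. ennreal (\<pi> s a)))"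
      using K by (intro nn_integral_bind[OF f]) (simp cong: measurable_cong_sets)
    moreover note borel_measurable_policy_section[OF \<pi> s]
    ultimately show "(\<integral>\<^sup>+x. f x \<partial>(density da (\<lambda>a. ennreal (\<pi> s a)) \<bind> (\<lambda>a. PR (s, a) \<bind> (\<lambda>r. return R (\<phi> (s, a, r)))))) =
      (\<integral>\<^sup>+a. ennreal (\<pi> s a) * (\<integral>\<^sup>+r. f (\<phi> (s, a, r)) \<partial>PR (s, a)) \<partial>da)"
      by (subst (asm) nn_integral_density) (auto intro!: nn_integral_cong simp: inner s)
  qed
  finally show ?thesis .
qed

lemma data_law_eq: "data_law PS da PR \<pi> = bandit_law \<pi> (PS \<Otimes>\<^sub>M da \<Otimes>\<^sub>M borel) (\<lambda>x. x)"
  by (simp add: data_law_def bandit_law_def)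

lemma target_law_eq: "target_law PS da PR \<pi> = bandit_law \<pi> (PS \<Otimes>\<^sub>M borel) (\<lambda>(s, a, r). (s, r))"
  by (simp add: target_law_def bandit_law_def)

lemma
  assumes "policy PS da \<pi>"
  shows prob_space_data_law: "prob_space (data_law PS da PR \<pi>)"
    and sets_data_law: "sets (data_law PS da PR \<pi>) = sets (PS \<Otimes>\<^sub>M da \<Otimes>\<^sub>M borel)"
    and prob_space_target_law: "prob_space (target_law PS da PR \<pi>)"
    and sets_target_law: "sets (target_law PS da PR \<pi>) = sets (PS \<Otimes>\<^sub>M borel)"
  unfolding data_law_eq target_law_eq
  by (intro prob_space_bandit_law sets_bandit_law assms; measurable)+

lemma
  assumes \<pi>: "policy PS da \<pi>" and s: "s \<in> space PS"
  shows prob_space_cond_reward_law: "prob_space (cond_reward_law da PR \<pi> s)"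
    and sets_cond_reward_law: "sets (cond_reward_law da PR \<pi> s) = sets borel"
    and nn_integral_cond_reward_law: "f \<in> borel_measurable borel \<Longrightarrow>
      (\<integral>\<^sup>+r. f r \<partial>cond_reward_law da PR \<pi> s) = (\<integral>\<^sup>+a. ennreal (\<pi> s a) * (\<integral>\<^sup>+r. f r \<partial>PR (s, a)) \<partial>da)"
proof -
  have d: "density da (\<lambda>a. ennreal (\<pi> s a)) \<in> space (prob_algebra da)"
    using measurable_space[OF policy_kernel[OF \<pi>] s] .
  note K = PR_section[OF s]
  show "prob_space (cond_reward_law da PR \<pi> s)"
    unfolding cond_reward_law_def by (rule prob_space_bind'[OF d K])
  have ne: "space da \<noteq> {}"
    using d prob_space.not_empty by (fastforce simp: space_prob_algebra)
  show "sets (cond_reward_law da PR \<pi> s) = sets borel"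
    unfolding cond_reward_law_def
    using ne by (intro sets_bind[OF sets_kernel[OF measurable_prob_algebraD[OF K]]]) auto
  assume f: "f \<in> borel_measurable borel"
  note borel_measurable_nn_integral_PR[OF s f]
  moreover note borel_measurable_policy_section[OF \<pi> s]
  moreover have "(\<integral>\<^sup>+r. f r \<partial>cond_reward_law da PR \<pi> s) =
      (\<integral>\<^sup>+a. \<integral>\<^sup>+r. f r \<partial>PR (s, a) \<partial>density da (\<lambda>a. ennreal (\<pi> s a)))"
    unfolding cond_reward_law_def using measurable_prob_algebraD[OF K]
    by (intro nn_integral_bind[OF f]) (simp cong: measurable_cong_sets)
  ultimately show "(\<integral>\<^sup>+r. f r \<partial>cond_reward_law da PR \<pi> s) = (\<integral>\<^sup>+a. ennreal (\<pi> s a) * (\<integral>\<^sup>+r. f r \<partial>PR (s, a)) \<partial>da)"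
    by (subst (asm) nn_integral_density) auto
qed

lemma nn_integral_target_law_cond:
  assumes \<pi>: "policy PS da \<pi>" and f[measurable]: "f \<in> borel_measurable (PS \<Otimes>\<^sub>M borel)"
  shows "(\<integral>\<^sup>+x. f x \<partial>target_law PS da PR \<pi>) = (\<integral>\<^sup>+s. \<integral>\<^sup>+r. f (s, r) \<partial>cond_reward_law da PR \<pi> s \<partial>PS)"
  unfolding target_law_eq
  by (subst nn_integral_bandit_law[OF \<pi> _ f]) (auto intro!: nn_integral_cong simp: nn_integral_cond_reward_law[OF \<pi>])

section \<open>Ratio bound and importance weighting\<close>

lemma ratio_bound_attained:
  assumes \<pi>b: "policy PS da \<pi>b" and \<pi>e: "policy PS da \<pi>e" and fin: "ratio_bound PS da \<pi>b \<pi>e < \<infinity>"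
  obtains b where "ratio_bound PS da \<pi>b \<pi>e = ereal b" "1 \<le> b"
    "\<And>s a. s \<in> space PS \<Longrightarrow> a \<in> space da \<Longrightarrow> \<pi>e s a \<le> b * \<pi>b s a"
proof -
  let ?S = "{b. \<forall>s\<in>space PS. \<forall>a\<in>space da. \<pi>e s a \<le> b * \<pi>b s a}"
  have ne: "?S \<noteq> {}"
  proof
    assume "?S = {}"
    then have "ratio_bound PS da \<pi>b \<pi>e = \<infinity>"
      unfolding ratio_bound_def by (simp only: image_empty Inf_empty top_ereal_def)
    then show False using fin by simp
  qed
  have nonneg: "0 \<le> \<pi>b s a" if "s \<in> space PS" "a \<in> space da" for s a
    using \<pi>b that by (simp add: policy_def)
  \<comment> \<open>Both densities integrate to 1 at any one context, so no admissible bound is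
    below 1. This is what makes \<open>1 / b\<close> a probability.\<close>
  have ge1: "1 \<le> b" if b: "b \<in> ?S" for b
  proof -
    obtain s where s: "s \<in> space PS" using not_empty by auto
    have total: "(\<integral>\<^sup>+a. ennreal (\<pi> s a) \<partial>da) = 1" and meas: "(\<lambda>a. \<pi> s a) \<in> borel_measurable da"
      if "policy PS da \<pi>" for \<pi>
    proof -
      show m: "(\<lambda>a. \<pi> s a) \<in> borel_measurable da"
        by (rule borel_measurable_policy_section[OF that s])
      have "density da (\<lambda>a. ennreal (\<pi> s a)) \<in> space (prob_algebra da)"
        using measurable_space[OF policy_kernel[OF that] s] .
      from in_space_prob_algebra[OF this] show "(\<integral>\<^sup>+a. ennreal (\<pi> s a) \<partial>da) = 1"
        using m by (simp add: emeasure_density cong: nn_integral_cong)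
    qed
    have "1 = (\<integral>\<^sup>+a. ennreal (\<pi>e s a) \<partial>da)" using total[OF \<pi>e] by simp
    also have "\<dots> \<le> (\<integral>\<^sup>+a. ennreal b * ennreal (\<pi>b s a) \<partial>da)"
      using b s nonneg by (intro nn_integral_mono) (auto simp: ennreal_mult''[symmetric] intro!: ennreal_leI)
    also have "\<dots> = ennreal b"
      using total[OF \<pi>b] meas[OF \<pi>b] by (subst nn_integral_cmult) auto
    finally show "1 \<le> b" by simp
  qed
  then have bdd: "bdd_below ?S" by (intro bdd_belowI)
  have "ratio_bound PS da \<pi>b \<pi>e = ereal (Inf ?S)"
    unfolding ratio_bound_def by (rule ereal_Inf'[OF bdd ne, symmetric])
  moreover have "1 \<le> Inf ?S" using ne ge1 by (intro cInf_greatest) auto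
  moreover have "\<pi>e s a \<le> Inf ?S * \<pi>b s a" if sa: "s \<in> space PS" "a \<in> space da" for s a
  proof (cases "\<pi>b s a = 0")
    \<comment> \<open>No quotient is available where \<pi>b vanishes, but any single admissible
      bound already forces \<open>\<pi>e s a \<le> 0\<close> there.\<close>
    case True
    obtain b where "b \<in> ?S" using ne by blast
    then have "\<pi>e s a \<le> b * \<pi>b s a" using sa by blast
    then show ?thesis using True by simp
  next
    case False
    then have pos: "0 < \<pi>b s a" using nonneg[OF sa] by simp
    have "\<pi>e s a / \<pi>b s a \<le> Inf ?S"
      using ne sa pos by (intro cInf_greatest) (auto simp: field_simps)
    then show ?thesis using pos by (simp add: field_simps)
  qed
  ultimately show ?thesis using that by blast
qed

lemma borel_measurable_weight:
  assumes \<pi>b: "policy PS da \<pi>b" and \<pi>e: "policy PS da \<pi>e"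
  shows "(\<lambda>x. weight \<pi>b \<pi>e (fst x) (fst (snd x))) \<in> borel_measurable (PS \<Otimes>\<^sub>M da \<Otimes>\<^sub>M (borel :: real measure))"
proof -
  have [measurable]: "(\<lambda>x. \<pi> (fst x) (fst (snd x))) \<in> borel_measurable (PS \<Otimes>\<^sub>M da \<Otimes>\<^sub>M (borel :: real measure))"
    if "policy PS da \<pi>" for \<pi>
  proof -
    have "(\<lambda>x. (fst x, fst (snd x))) \<in> PS \<Otimes>\<^sub>M da \<Otimes>\<^sub>M (borel :: real measure) \<rightarrow>\<^sub>M PS \<Otimes>\<^sub>M da" by measurable
    from measurable_compose[OF this borel_measurable_policy[OF that]] show ?thesis by simp
  qed
  note [measurable] = this[OF \<pi>b] this[OF \<pi>e]
  show ?thesis unfolding weight_def by measurable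
qed

text \<open>Importance weighting: \<pi>b times the weight is \<pi>e. Where \<pi>b vanishes the bound
  makes \<pi>e vanish too, so the convention for division by zero loses no mass. For f an indicator
  this is the law of an accepted pair, with acceptance rate \<open>1 / b\<close>.\<close>

lemma nn_integral_weight:
  assumes \<pi>b: "policy PS da \<pi>b" and \<pi>e: "policy PS da \<pi>e" and b: "0 < b"
    and bound: "\<And>s a. s \<in> space PS \<Longrightarrow> a \<in> space da \<Longrightarrow> \<pi>e s a \<le> b * \<pi>b s a"
    and f[measurable]: "f \<in> borel_measurable (PS \<Otimes>\<^sub>M borel)"
  shows "(\<integral>\<^sup>+(s, a, r). ennreal (weight \<pi>b \<pi>e s a / b) * f (s, r) \<partial>data_law PS da PR \<pi>b) =
    ennreal (1 / b) * (\<integral>\<^sup>+x. f x \<partial>target_law PS da PR \<pi>e)"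
proof -
  note [measurable] = borel_measurable_policy[OF \<pi>b] borel_measurable_policy[OF \<pi>e]
    measurable_prob_algebraD[OF PR]
  have w: "ennreal (\<pi>b s a) * ennreal (weight \<pi>b \<pi>e s a / b) = ennreal (1 / b) * ennreal (\<pi>e s a)"
    if sa: "s \<in> space PS" "a \<in> space da" for s a
  proof -
    have "0 \<le> \<pi>b s a" "0 \<le> \<pi>e s a" using \<pi>b \<pi>e sa by (auto simp: policy_def)
    moreover have "\<pi>b s a = 0 \<Longrightarrow> \<pi>e s a = 0" using bound[OF sa] \<open>0 \<le> \<pi>e s a\<close> by simp
    ultimately show ?thesis
      using b by (auto simp: weight_def ennreal_mult''[symmetric] field_simps)
  qed
  have m: "(\<lambda>(s, a, r). ennreal (weight \<pi>b \<pi>e s a / b) * f (s, r)) \<in> borel_measurable (PS \<Otimes>\<^sub>M da \<Otimes>\<^sub>M borel)"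
    using borel_measurable_weight[OF \<pi>b \<pi>e] by measurable
  have f_PR: "(\<lambda>r. f (s, r)) \<in> borel_measurable (PR (s, a))" if "s \<in> space PS" "a \<in> space da" for s a
  proof -
    have "sets (PR (s, a)) = sets borel"
      using measurable_space[OF PR, of "(s, a)"] that by (auto simp: space_prob_algebra space_pair_measure)
    moreover have "(\<lambda>r. f (s, r)) \<in> borel_measurable borel" using that(1) by measurable
    ultimately show ?thesis by (simp cong: measurable_cong_sets)
  qed
  have "(\<integral>\<^sup>+(s, a, r). ennreal (weight \<pi>b \<pi>e s a / b) * f (s, r) \<partial>data_law PS da PR \<pi>b) =
     (\<integral>\<^sup>+s. \<integral>\<^sup>+a. ennreal (\<pi>b s a) * (\<integral>\<^sup>+r. ennreal (weight \<pi>b \<pi>e s a / b) * f (s, r) \<partial>PR (s, a)) \<partial>da \<partial>PS)"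
    unfolding data_law_eq by (subst nn_integral_bandit_law[OF \<pi>b _ m]) auto
  also have "\<dots> = (\<integral>\<^sup>+s. \<integral>\<^sup>+a. ennreal (1 / b) * (ennreal (\<pi>e s a) * (\<integral>\<^sup>+r. f (s, r) \<partial>PR (s, a))) \<partial>da \<partial>PS)"
    by (intro nn_integral_cong) (simp add: nn_integral_cmult[OF f_PR] w mult.assoc[symmetric])
  also have "\<dots> = (\<integral>\<^sup>+s. ennreal (1 / b) * (\<integral>\<^sup>+a. ennreal (\<pi>e s a) * (\<integral>\<^sup>+r. f (s, r) \<partial>PR (s, a)) \<partial>da) \<partial>PS)"
    by (intro nn_integral_cong nn_integral_cmult borel_measurable_times_ennreal measurable_compose[OF _ measurable_ennreal]
        borel_measurable_policy_section[OF \<pi>e] borel_measurable_nn_integral_PR) auto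
  also have "\<dots> = ennreal (1 / b) * (\<integral>\<^sup>+s. \<integral>\<^sup>+a. ennreal (\<pi>e s a) * (\<integral>\<^sup>+r. f (s, r) \<partial>PR (s, a)) \<partial>da \<partial>PS)"
  \<comment> \<open>\<open>da\<close> is an arbitrary measure, for which measurability of parameter
    integrals is not at hand; it is taken from the kernel \<open>cond_reward_law\<close>
    instead.\<close>
  proof (rule nn_integral_cmult)
    have "(\<lambda>s. \<integral>\<^sup>+r. f (s, r) \<partial>cond_reward_law da PR \<pi>e s) \<in> borel_measurable PS"
      unfolding cond_reward_law_def
      by (rule nn_integral_measurable_subprob_algebra2[where N=borel])
        (auto intro!: measurable_prob_algebraD measurable_bind_prob_space2[where N=da] policy_kernel[OF \<pi>e]
           simp: PR)
    then show "(\<lambda>s. \<integral>\<^sup>+a. ennreal (\<pi>e s a) * (\<integral>\<^sup>+r. f (s, r) \<partial>PR (s, a)) \<partial>da) \<in> borel_measurable PS"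
      by (subst measurable_cong[OF nn_integral_cond_reward_law[OF \<pi>e, symmetric]]) auto
  qed
  also have "(\<integral>\<^sup>+s. \<integral>\<^sup>+a. ennreal (\<pi>e s a) * (\<integral>\<^sup>+r. f (s, r) \<partial>PR (s, a)) \<partial>da \<partial>PS) =
      (\<integral>\<^sup>+x. f x \<partial>target_law PS da PR \<pi>e)"
    unfolding target_law_eq by (subst nn_integral_bandit_law[OF \<pi>e _ f]) auto
  finally show ?thesis .
qed

text \<open>At a fixed context the score is at most 0 on the closed interval between the quantiles
  and negative on the open one. The quantile inequalities bound the first mass below and the second
  above by \<open>p' - p\<close>, atoms or not, and integration over the contexts keeps both
  bounds.\<close>

lemma score_quantiles:
  assumes \<pi>: "policy PS da \<pi>" and p: "p < p'"
    and q[measurable]: "q \<in> borel_measurable PS" "q' \<in> borel_measurable PS"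
    and lo: "AE s in PS. is_quantile (cond_reward_law da PR \<pi> s) p (q s)"
    and up: "AE s in PS. is_quantile (cond_reward_law da PR \<pi> s) p' (q' s)"
  defines "\<nu> \<equiv> target_law PS da PR \<pi>"
  shows "p' - p \<le> measure \<nu> {x \<in> space \<nu>. score q q' x \<le> 0}"
    and "measure \<nu> {x \<in> space \<nu>. score q q' x < 0} \<le> p' - p"
proof -
  interpret \<nu>: prob_space \<nu> unfolding \<nu>_def by (rule prob_space_target_law[OF \<pi>])
  have sets_\<nu>[measurable_cong]: "sets \<nu> = sets (PS \<Otimes>\<^sub>M borel)" unfolding \<nu>_def by (rule sets_target_law[OF \<pi>])
  have [measurable]: "score q q' \<in> borel_measurable (PS \<Otimes>\<^sub>M borel)" unfolding score_def by measurable
  have emeasure_\<nu>: "emeasure \<nu> {x \<in> space \<nu>. P (score q q' x)} =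
      (\<integral>\<^sup>+s. emeasure (cond_reward_law da PR \<pi> s) {r. P (score q q' (s, r))} \<partial>PS)"
    if P[measurable]: "Measurable.pred borel P" for P
  proof -
    have "emeasure \<nu> {x \<in> space \<nu>. P (score q q' x)} = (\<integral>\<^sup>+x. indicator {x \<in> space \<nu>. P (score q q' x)} x \<partial>\<nu>)"
      by (subst nn_integral_indicator) auto
    also have "\<dots> = (\<integral>\<^sup>+x. indicator {x. P (score q q' x)} x \<partial>\<nu>)"
      by (intro nn_integral_cong) (auto split: split_indicator)
    also have "\<dots> = (\<integral>\<^sup>+s. \<integral>\<^sup>+r. indicator {x. P (score q q' x)} (s, r) \<partial>cond_reward_law da PR \<pi> s \<partial>PS)"
      unfolding \<nu>_def by (intro nn_integral_target_law_cond[OF \<pi>]) measurable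
    also have "\<dots> = (\<integral>\<^sup>+s. emeasure (cond_reward_law da PR \<pi> s) {r. P (score q q' (s, r))} \<partial>PS)"
    proof (intro nn_integral_cong)
      fix s assume s[measurable]: "s \<in> space PS"
      note [measurable_cong] = sets_cond_reward_law[OF \<pi> s]
      have "{r \<in> space borel. P (score q q' (s, r))} \<in> sets borel" by measurable
      then have "{r. P (score q q' (s, r))} \<in> sets (cond_reward_law da PR \<pi> s)"
        by (simp add: sets_cond_reward_law[OF \<pi> s])
      from nn_integral_indicator[OF this]
      show "(\<integral>\<^sup>+r. indicator {x. P (score q q' x)} (s, r) \<partial>cond_reward_law da PR \<pi> s) =
         emeasure (cond_reward_law da PR \<pi> s) {r. P (score q q' (s, r))}"
        by (simp add: indicator_def)
    qed
    finally show ?thesis .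
  qed
  have bounds: "AE s in PS. ennreal (p' - p) \<le> emeasure (cond_reward_law da PR \<pi> s) {r. score q q' (s, r) \<le> 0}
      \<and> emeasure (cond_reward_law da PR \<pi> s) {r. score q q' (s, r) < 0} \<le> ennreal (p' - p)"
    using lo up AE_space
  proof eventually_elim
    case (elim s)
    interpret c: prob_space "cond_reward_law da PR \<pi> s"
      by (rule prob_space_cond_reward_law[OF \<pi> elim(3)])
    note [simp] = sets_cond_reward_law[OF \<pi> elim(3)]
    have Q: "c.prob {..<q s} \<le> p" "p \<le> c.prob {..q s}" "c.prob {..<q' s} \<le> p'" "p' \<le> c.prob {..q' s}"
      using elim by (auto simp: is_quantile_def)
    have "q s \<le> q' s"
    proof (rule ccontr)
      assume "\<not> q s \<le> q' s"
      then have "c.prob {..q' s} \<le> c.prob {..<q s}" by (intro c.finite_measure_mono) auto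
      then show False using Q p by linarith
    qed
    have "{r. score q q' (s, r) \<le> 0} = {..q' s} - {..<q s}" by (auto simp: score_def)
    moreover have "{..<q s} \<subseteq> {..q' s}" using \<open>q s \<le> q' s\<close> by auto
    ultimately have "c.prob {r. score q q' (s, r) \<le> 0} = c.prob {..q' s} - c.prob {..<q s}"
      using c.finite_measure_Diff[of "{..q' s}" "{..<q s}"] by simp
    then have 1: "p' - p \<le> c.prob {r. score q q' (s, r) \<le> 0}" using Q by linarith
    have eq: "{r. score q q' (s, r) < 0} = {..<q' s} - {..q s}" by (auto simp: score_def)
    have 2: "c.prob {r. score q q' (s, r) < 0} \<le> p' - p"
    \<comment> \<open>If the quantiles coincide the half-lines are no longer nested, but the open
      interval between them is empty.\<close>
    proof (cases "q s < q' s")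
      case True
      then have "c.prob {r. score q q' (s, r) < 0} = c.prob {..<q' s} - c.prob {..q s}"
        unfolding eq by (intro c.finite_measure_Diff) auto
      then show ?thesis using Q by linarith
    next
      case False
      then have "{r. score q q' (s, r) < 0} = {}" unfolding eq by auto
      then show ?thesis using p by simp
    qed
    show ?case using 1 2 by (simp add: c.emeasure_eq_measure ennreal_leI)
  qed
  have "ennreal (p' - p) = (\<integral>\<^sup>+s. ennreal (p' - p) \<partial>PS)" by (simp add: emeasure_space_1)
  also have "\<dots> \<le> emeasure \<nu> {x \<in> space \<nu>. score q q' x \<le> 0}"
    unfolding emeasure_\<nu>[of "\<lambda>x. x \<le> 0", simplified] using bounds by (intro nn_integral_mono_AE) auto
  finally show "p' - p \<le> measure \<nu> {x \<in> space \<nu>. score q q' x \<le> 0}"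
    by (simp add: \<nu>.emeasure_eq_measure)
  have "emeasure \<nu> {x \<in> space \<nu>. score q q' x < 0} \<le> (\<integral>\<^sup>+s. ennreal (p' - p) \<partial>PS)"
    unfolding emeasure_\<nu>[of "\<lambda>x. x < 0", simplified] using bounds by (intro nn_integral_mono_AE) auto
  also have "\<dots> = ennreal (p' - p)" by (simp add: emeasure_space_1)
  finally show "measure \<nu> {x \<in> space \<nu>. score q q' x < 0} \<le> p' - p"
    using p by (simp add: \<nu>.emeasure_eq_measure)
qed

end

section \<open>Rejection sampling\<close>

abbreviation "unif01 \<equiv> uniform_measure lborel {0..1::real}"

lemma prob_space_unif01: "prob_space unif01"
  by (rule prob_space_uniform_measure) auto

lemma emeasure_unif01_atMost:
  assumes "0 \<le> x" "x \<le> 1"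
  shows "emeasure unif01 {..x} = ennreal x" and "emeasure unif01 {x<..} = ennreal (1 - x)"
proof -
  have "{0..1} \<inter> {..x} = {0..x}" "{0..1} \<inter> {x<..} = {x<..1}" using assms by auto
  then show "emeasure unif01 {..x} = ennreal x" and "emeasure unif01 {x<..} = ennreal (1 - x)"
    using assms by (simp_all add: emeasure_uniform_measure divide_ennreal_def)
qed

text \<open>Thinning in the abstract: u is the acceptance probability of a point, and
  \<open>accept\<close> says that \<mu> thinned by u and mapped by \<phi> is p times \<nu>. With A
  the whole space, p is the overall acceptance rate.\<close>

locale rejection_sampling =
  \<mu>: prob_space \<mu> + \<nu>: prob_space \<nu> for \<mu> :: "'x measure" and \<nu> :: "'y measure" +
  fixes u :: "'x \<Rightarrow> real" and \<phi> :: "'x \<Rightarrow> 'y" and p :: real and n :: nat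
  assumes u[measurable]: "u \<in> borel_measurable \<mu>" and u01: "\<And>x. x \<in> space \<mu> \<Longrightarrow> 0 \<le> u x \<and> u x \<le> 1"
    and \<phi>[measurable]: "\<phi> \<in> \<mu> \<rightarrow>\<^sub>M \<nu>" and p: "0 \<le> p" "p \<le> 1"
    and accept: "\<And>A. A \<in> sets \<nu> \<Longrightarrow> (\<integral>\<^sup>+x. ennreal (u x) * indicator A (\<phi> x) \<partial>\<mu>) = ennreal p * emeasure \<nu> A"
begin

abbreviation "data \<equiv> \<Pi>\<^sub>M i\<in>{..<n}. \<mu>"
abbreviation "coins \<equiv> \<Pi>\<^sub>M i\<in>{..<n}. unif01"

sublocale U: prob_space unif01 by (rule prob_space_unif01)
sublocale prod_\<mu>: product_prob_space "\<lambda>_::nat. \<mu>" ..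
sublocale prod_\<nu>: product_prob_space "\<lambda>_::nat. \<nu>" ..
sublocale prod_U: product_prob_space "\<lambda>_::nat. unif01" ..
sublocale data: prob_space data by (intro prob_space_PiM \<mu>.prob_space_axioms)
sublocale coins: prob_space coins by (intro prob_space_PiM U.prob_space_axioms)

definition accepted :: "nat set \<Rightarrow> (nat \<Rightarrow> 'x) \<Rightarrow> (nat \<Rightarrow> real) \<Rightarrow> bool" where
  "accepted I d v \<longleftrightarrow> (\<forall>i\<in>{..<n}. v i \<le> u (d i) \<longleftrightarrow> i \<in> I)"

text \<open>Conditional probability, given the data d, that the accepted indices are exactly those
  in I.\<close>

definition accept_weight :: "nat set \<Rightarrow> (nat \<Rightarrow> 'x) \<Rightarrow> ennreal" where
  "accept_weight I d = (\<Prod>i<n. ennreal (if i \<in> I then u (d i) else 1 - u (d i)))"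

text \<open>The list c enumerates the accepted indices in an order of free choice, which later puts
  the training positions first.\<close>

definition reindex :: "nat list \<Rightarrow> (nat \<Rightarrow> 'x) \<Rightarrow> nat \<Rightarrow> 'y" where
  "reindex c d = (\<lambda>j\<in>{..<length c}. \<phi> (d (c ! j)))"

lemma measurable_reindex:
  assumes "set c \<subseteq> {..<n}"
  shows "reindex c \<in> data \<rightarrow>\<^sub>M (\<Pi>\<^sub>M j\<in>{..<length c}. \<nu>)"
proof -
  have "(\<lambda>d. \<phi> (d (c ! j))) \<in> data \<rightarrow>\<^sub>M \<nu>" if "j \<in> {..<length c}" for j
  proof -
    have "c ! j \<in> {..<n}" using that assms nth_mem by blast
    from measurable_compose[OF measurable_component_singleton[OF this] \<phi>] show ?thesis .
  qed
  then show ?thesis unfolding reindex_def by (rule measurable_restrict)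
qed

lemma pred_accepted:
  assumes d: "f \<in> N \<rightarrow>\<^sub>M data" and v: "g \<in> N \<rightarrow>\<^sub>M coins"
  shows "Measurable.pred N (\<lambda>x. accepted I (f x) (g x))"
  unfolding accepted_def
proof (rule pred_intros_finite)
  fix i assume i: "i \<in> {..<n}"
  have [measurable]: "(\<lambda>x. f x i) \<in> N \<rightarrow>\<^sub>M \<mu>"
    by (rule measurable_compose[OF d measurable_component_singleton[OF i]])
  have [measurable]: "(\<lambda>x. g x i) \<in> borel_measurable N"
    using measurable_compose[OF v measurable_component_singleton[OF i]] by (simp cong: measurable_cong_sets)
  show "Measurable.pred N (\<lambda>x. (g x i \<le> u (f x i)) = (i \<in> I))"
    by (cases "i \<in> I") simp_all
qed simp

lemma borel_measurable_accept_weight[measurable]: "accept_weight I \<in> borel_measurable data"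
  unfolding accept_weight_def by measurable

lemma nn_integral_reject: "(\<integral>\<^sup>+x. ennreal (1 - u x) \<partial>\<mu>) = ennreal (1 - p)"
proof -
  have "(\<integral>\<^sup>+x. ennreal (u x) \<partial>\<mu>) = (\<integral>\<^sup>+x. ennreal (u x) * indicator (space \<nu>) (\<phi> x) \<partial>\<mu>)"
    using measurable_space[OF \<phi>] by (intro nn_integral_cong) auto
  also have "\<dots> = ennreal p" by (subst accept) (auto simp: \<nu>.emeasure_space_1)
  finally have P: "(\<integral>\<^sup>+x. ennreal (u x) \<partial>\<mu>) = ennreal p" .
  have "(\<integral>\<^sup>+x. ennreal (u x) + ennreal (1 - u x) \<partial>\<mu>) = (\<integral>\<^sup>+x. 1 \<partial>\<mu>)"
    using u01 by (intro nn_integral_cong) (simp add: ennreal_plus[symmetric] del: ennreal_plus)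
  then have "ennreal p + (\<integral>\<^sup>+x. ennreal (1 - u x) \<partial>\<mu>) = ennreal p + ennreal (1 - p)"
    using p by (simp add: nn_integral_add P \<mu>.emeasure_space_1 ennreal_plus[symmetric] del: ennreal_plus)
  then show ?thesis by (simp add: ennreal_add_left_cancel)
qed

text \<open>For fixed data the event is a box in coin space, and each of its sides is a half-line
  whose uniform mass is an acceptance or rejection probability.\<close>

lemma emeasure_coins_accepted:
  assumes d: "d \<in> space data"
  shows "emeasure coins {v \<in> space coins. accepted I d v} = accept_weight I d"
proof -
  let ?A = "\<lambda>i. if i \<in> I then {..u (d i)} else {u (d i)<..}"
  have "{v \<in> space coins. accepted I d v} = Pi\<^sub>E {..<n} ?A" (is "?V = _")
  proof -
    have "v \<in> ?V \<longleftrightarrow> v \<in> Pi\<^sub>E {..<n} ?A" for v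
    proof -
      have "v i \<in> ?A i \<longleftrightarrow> (v i \<le> u (d i) \<longleftrightarrow> i \<in> I)" for i by (cases "i \<in> I") auto
      then show ?thesis by (simp add: accepted_def space_PiM PiE_iff) blast
    qed
    then show ?thesis by blast
  qed
  then have "emeasure coins {v \<in> space coins. accepted I d v} = (\<Prod>i<n. emeasure unif01 (?A i))"
    by (simp only:) (rule prod_U.emeasure_PiM, auto)
  also have "\<dots> = accept_weight I d"
    unfolding accept_weight_def
  proof (intro prod.cong refl)
    fix i assume "i \<in> {..<n}"
    then have "d i \<in> space \<mu>" using d by (auto simp: space_PiM)
    from u01[OF this] show "emeasure unif01 (?A i) = ennreal (if i \<in> I then u (d i) else 1 - u (d i))"
      by (cases "i \<in> I") (simp_all only: if_True if_False emeasure_unif01_atMost)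
  qed
  finally show ?thesis .
qed

text \<open>The i.i.d. property of the accepted pairs, for any enumeration c of the accepted set.
  Scaling the product measure instead of normalising the left-hand side avoids a division by the
  probability of the acceptance event.\<close>

lemma distr_reindex_accepted:
  assumes c: "distinct c" "set c \<subseteq> {..<n}"
  shows "distr (density data (accept_weight (set c))) (\<Pi>\<^sub>M j\<in>{..<length c}. \<nu>) (reindex c) =
    scale_measure (ennreal (p ^ length c * (1 - p) ^ (n - length c))) (\<Pi>\<^sub>M j\<in>{..<length c}. \<nu>)"
    (is "?L = ?R")
proof -
  let ?N = "length c" and ?P = "\<Pi>\<^sub>M j\<in>{..<length c}. \<nu>"
  note [measurable] = measurable_reindex[OF c(2)]
  have rect: "emeasure ?L (Pi\<^sub>E {..<?N} A) = emeasure ?R (Pi\<^sub>E {..<?N} A)"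
    if A: "\<And>j. j \<in> {..<?N} \<Longrightarrow> A j \<in> sets \<nu>" for A
  proof -
    have bij: "bij_betw ((!) c) {..<?N} (set c)" using c(1) by (rule bij_betw_nth) auto
    \<comment> \<open>The position of an accepted index in c; it tells which side of the rectangle
      the point with this index has to meet.\<close>
    define idx where "idx = the_inv_into {..<?N} ((!) c)"
    have idx: "idx (c ! j) = j" if "j < ?N" for j
      unfolding idx_def using bij that by (intro the_inv_into_f_f) (auto simp: bij_betw_def)
    have idx_less: "idx i < ?N" "c ! idx i = i" if "i \<in> set c" for i
      using that idx by (auto simp: in_set_conv_nth)
    \<comment> \<open>The factor of the integrand at coordinate i. A point missing its side makes
      the whole product 0, and after integration an accepted index contributes p times a \<nu>-mass
      and a rejected one \<open>1 - p\<close>.\<close>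
    define g where "g i x = (if i \<in> set c then ennreal (u x) * indicator (A (idx i)) (\<phi> x) else ennreal (1 - u x))" for i x
    have g[measurable]: "g i \<in> borel_measurable \<mu>" for i
    proof (cases "i \<in> set c")
      case True
      then have [measurable]: "A (idx i) \<in> sets \<nu>" using A idx_less by auto
      show ?thesis unfolding g_def using True by simp
    next
      case False
      then show ?thesis unfolding g_def by simp
    qed
    have int_g: "(\<integral>\<^sup>+x. g i x \<partial>\<mu>) = (if i \<in> set c then ennreal p * emeasure \<nu> (A (idx i)) else ennreal (1 - p))" for i
      using A idx_less(1)[of i] by (auto simp: g_def accept nn_integral_reject)
    have rect_meas[measurable]: "Pi\<^sub>E {..<?N} A \<in> sets ?P" using A by (intro sets_PiM_I_finite) auto
    have "emeasure ?L (Pi\<^sub>E {..<?N} A) =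
        emeasure (density data (accept_weight (set c))) (reindex c -` Pi\<^sub>E {..<?N} A \<inter> space data)"
      using measurable_reindex[OF c(2)] by (subst emeasure_distr) (simp_all add: rect_meas)
    also have "\<dots> = (\<integral>\<^sup>+d\<in>reindex c -` Pi\<^sub>E {..<?N} A \<inter> space data. accept_weight (set c) d \<partial>data)"
      by (intro emeasure_density borel_measurable_accept_weight measurable_sets[OF measurable_reindex[OF c(2)] rect_meas])
    also have "\<dots> = (\<integral>\<^sup>+d. accept_weight (set c) d * indicator (Pi\<^sub>E {..<?N} A) (reindex c d) \<partial>data)"
      by (intro nn_integral_cong) (simp add: indicator_def)
    also have "\<dots> = (\<integral>\<^sup>+d. (\<Prod>i<n. g i (d i)) \<partial>data)"
    proof (intro nn_integral_cong)
      fix d assume "d \<in> space data"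
      show "accept_weight (set c) d * indicator (Pi\<^sub>E {..<?N} A) (reindex c d) = (\<Prod>i<n. g i (d i))"
      proof (cases "\<forall>j<?N. \<phi> (d (c ! j)) \<in> A j")
        case True
        then have "g i (d i) = ennreal (if i \<in> set c then u (d i) else 1 - u (d i))" for i
          using idx_less[of i] by (auto simp: g_def split: split_indicator)
        moreover have "reindex c d \<in> Pi\<^sub>E {..<?N} A" using True by (auto simp: reindex_def)
        ultimately show ?thesis by (simp add: accept_weight_def)
      next
        case False
        then obtain j where j: "j < ?N" "\<phi> (d (c ! j)) \<notin> A j" by blast
        then have "g (c ! j) (d (c ! j)) = 0" by (simp add: g_def idx)
        moreover have "c ! j < n" using j c(2) nth_mem by blast
        ultimately have "(\<Prod>i<n. g i (d i)) = 0" by (intro prod_zero) auto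
        moreover have "reindex c d \<notin> Pi\<^sub>E {..<?N} A"
          using j by (auto simp: reindex_def PiE_iff)
        ultimately show ?thesis by simp
      qed
    qed
    also have "\<dots> = (\<Prod>i<n. \<integral>\<^sup>+x. g i x \<partial>\<mu>)"
      by (rule prod_\<mu>.product_nn_integral_prod) auto
    also have "\<dots> = (\<Prod>i\<in>set c. ennreal p * emeasure \<nu> (A (idx i))) * (\<Prod>i\<in>{..<n} - set c. ennreal (1 - p))"
      unfolding int_g using c(2)
      by (subst prod.subset_diff[of "set c"]) (auto simp: mult.commute)
    also have "(\<Prod>i\<in>{..<n} - set c. ennreal (1 - p)) = ennreal (1 - p) ^ (n - ?N)"
      using c by (simp add: card_Diff_subset distinct_card)
    also have "(\<Prod>i\<in>set c. ennreal p * emeasure \<nu> (A (idx i))) = (\<Prod>j<?N. ennreal p * emeasure \<nu> (A j))"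
      by (subst prod.reindex_bij_betw[OF bij, symmetric]) (auto simp: idx)
    also have "(\<Prod>j<?N. ennreal p * emeasure \<nu> (A j)) * ennreal (1 - p) ^ (n - ?N) =
        ennreal (p ^ ?N * (1 - p) ^ (n - ?N)) * (\<Prod>j<?N. emeasure \<nu> (A j))"
      using p by (simp add: prod.distrib ennreal_mult ennreal_power mult_ac)
    also have "\<dots> = emeasure ?R (Pi\<^sub>E {..<?N} A)"
      by (subst emeasure_scale_measure, subst prod_\<nu>.emeasure_PiM) (use A in auto)
    finally show ?thesis .
  qed
  show ?thesis
  \<comment> \<open>Rectangles generate the product space, and a constant exhausting sequence
    suffices because the whole space has finite mass.\<close>
  proof (rule measure_eqI_PiM_finite[where I = "{..<?N}" and A = "\<lambda>_::nat. Pi\<^sub>E {..<?N} (\<lambda>_. space \<nu>)"])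
    show "range (\<lambda>_::nat. Pi\<^sub>E {..<?N} (\<lambda>_. space \<nu>)) \<subseteq> prod_algebra {..<?N} (\<lambda>_. \<nu>)"
      by (auto intro!: prod_algebraI_finite)
    show "emeasure ?L (Pi\<^sub>E {..<?N} (\<lambda>_. space \<nu>)) \<noteq> \<infinity>"
      by (subst rect, simp, subst emeasure_scale_measure, subst prod_\<nu>.emeasure_PiM)
        (simp_all add: \<nu>.emeasure_space_1)
  qed (use rect in \<open>auto simp: space_PiM\<close>)
qed

text \<open>By independence the mass splits into the probability of accepting exactly
  \<open>set c\<close>, that of H for the splitting rule, and that of G for an i.i.d. sample with a
  fresh test pair. As c is fixed here, it may later be chosen according to the calibration positions
  that H prescribes.\<close>

lemma emeasure_accepted_event:
  fixes R :: "'j measure"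
  assumes c: "distinct c" "set c \<subseteq> {..<n}" and "prob_space R"
    and H[measurable]: "H \<in> sets R" and G[measurable]: "G \<in> sets ((\<Pi>\<^sub>M j\<in>{..<length c}. \<nu>) \<Otimes>\<^sub>M \<nu>)"
  defines "Z \<equiv> {(d, v, j, y) \<in> space (data \<Otimes>\<^sub>M coins \<Otimes>\<^sub>M R \<Otimes>\<^sub>M \<nu>).
      accepted (set c) d v \<and> j \<in> H \<and> (reindex c d, y) \<in> G}"
  shows "Z \<in> sets (data \<Otimes>\<^sub>M coins \<Otimes>\<^sub>M R \<Otimes>\<^sub>M \<nu>)"
    and "emeasure (data \<Otimes>\<^sub>M coins \<Otimes>\<^sub>M R \<Otimes>\<^sub>M \<nu>) Z =
      ennreal (p ^ length c * (1 - p) ^ (n - length c)) * emeasure R H *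
        emeasure ((\<Pi>\<^sub>M j\<in>{..<length c}. \<nu>) \<Otimes>\<^sub>M \<nu>) G"
proof -
  interpret R: prob_space R by fact
  let ?P = "\<Pi>\<^sub>M j\<in>{..<length c}. \<nu>"
  let ?M = "data \<Otimes>\<^sub>M coins \<Otimes>\<^sub>M R \<Otimes>\<^sub>M \<nu>"
  interpret R\<nu>: pair_prob_space R \<nu> ..
  interpret cR\<nu>: pair_prob_space coins "R \<Otimes>\<^sub>M \<nu>" ..
  note [measurable] = measurable_reindex[OF c(2)]
  have acc[measurable]: "Measurable.pred ?M (\<lambda>w. accepted (set c) (fst w) (fst (snd w)))"
    by (rule pred_accepted) measurable
  have ZG: "Z = {w \<in> space ?M. accepted (set c) (fst w) (fst (snd w)) \<and> fst (snd (snd w)) \<in> H \<and>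
      (reindex c (fst w), snd (snd (snd w))) \<in> G}"
    by (auto simp: Z_def)
  show Z: "Z \<in> sets ?M" unfolding ZG by measurable
  \<comment> \<open>Integrating out the test pair first leaves a function of the reindexed sample,
    to which the law of that sample applies.\<close>
  define \<psi> where "\<psi> x = (\<integral>\<^sup>+y. indicator G (x, y) \<partial>\<nu>)" for x
  have \<psi>[measurable]: "\<psi> \<in> borel_measurable ?P" unfolding \<psi>_def by measurable
  have "emeasure ?M Z = (\<integral>\<^sup>+d. \<integral>\<^sup>+w. indicator Z (d, w) \<partial>(coins \<Otimes>\<^sub>M R \<Otimes>\<^sub>M \<nu>) \<partial>data)"
    by (rule cR\<nu>.emeasure_pair_measure[OF Z])
  also have "\<dots> = (\<integral>\<^sup>+d. accept_weight (set c) d * (emeasure R H * \<psi> (reindex c d)) \<partial>data)"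
  proof (intro nn_integral_cong)
    fix d assume d[measurable]: "d \<in> space data"
    have [measurable]: "Measurable.pred coins (accepted (set c) d)"
      by (rule pred_accepted[of "\<lambda>_. d" _ "\<lambda>v. v"]) (use d in auto)
    have rd: "reindex c d \<in> space ?P" using measurable_space[OF measurable_reindex[OF c(2)] d] .
    then have [measurable]: "(\<lambda>y. (reindex c d, y)) \<in> \<nu> \<rightarrow>\<^sub>M ?P \<Otimes>\<^sub>M \<nu>" by simp
    have [measurable]: "(\<lambda>y. indicator G (reindex c d, y) :: ennreal) \<in> borel_measurable \<nu>"
      by measurable
    have "(\<integral>\<^sup>+w. indicator Z (d, w) \<partial>(coins \<Otimes>\<^sub>M R \<Otimes>\<^sub>M \<nu>)) =
      (\<integral>\<^sup>+w. indicator {v \<in> space coins. accepted (set c) d v} (fst w) *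
          (indicator H (fst (snd w)) * indicator G (reindex c d, snd (snd w))) \<partial>(coins \<Otimes>\<^sub>M R \<Otimes>\<^sub>M \<nu>))"
      using d by (intro nn_integral_cong) (auto simp: ZG space_pair_measure split: split_indicator)
    also have "\<dots> = (\<integral>\<^sup>+v. \<integral>\<^sup>+w. indicator {v \<in> space coins. accepted (set c) d v} v *
          (indicator H (fst w) * indicator G (reindex c d, snd w)) \<partial>(R \<Otimes>\<^sub>M \<nu>) \<partial>coins)"
      by (subst R\<nu>.nn_integral_fst[symmetric]) auto
    also have "\<dots> = (\<integral>\<^sup>+v. indicator {v \<in> space coins. accepted (set c) d v} v *
          (\<integral>\<^sup>+w. indicator H (fst w) * indicator G (reindex c d, snd w) \<partial>(R \<Otimes>\<^sub>M \<nu>)) \<partial>coins)"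
      by (intro nn_integral_cong nn_integral_cmult) auto
    also have "\<dots> = accept_weight (set c) d *
          (\<integral>\<^sup>+w. indicator H (fst w) * indicator G (reindex c d, snd w) \<partial>(R \<Otimes>\<^sub>M \<nu>))"
      by (subst nn_integral_multc) (auto simp: emeasure_coins_accepted[OF d])
    also have "(\<integral>\<^sup>+w. indicator H (fst w) * indicator G (reindex c d, snd w) \<partial>(R \<Otimes>\<^sub>M \<nu>)) =
        (\<integral>\<^sup>+j. \<integral>\<^sup>+y. indicator H j * indicator G (reindex c d, y) \<partial>\<nu> \<partial>R)"
      by (subst \<nu>.nn_integral_fst[symmetric]) auto
    also have "\<dots> = (\<integral>\<^sup>+j. indicator H j * \<psi> (reindex c d) \<partial>R)"
      unfolding \<psi>_def by (intro nn_integral_cong nn_integral_cmult) auto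
    also have "\<dots> = emeasure R H * \<psi> (reindex c d)"
      by (subst nn_integral_multc) auto
    finally show "(\<integral>\<^sup>+w. indicator Z (d, w) \<partial>(coins \<Otimes>\<^sub>M R \<Otimes>\<^sub>M \<nu>)) =
      accept_weight (set c) d * (emeasure R H * \<psi> (reindex c d))" .
  qed
  also have "\<dots> = emeasure R H * (\<integral>\<^sup>+d. accept_weight (set c) d * \<psi> (reindex c d) \<partial>data)"
    by (subst nn_integral_cmult[symmetric]) (auto intro!: nn_integral_cong simp: mult_ac)
  also have "(\<integral>\<^sup>+d. accept_weight (set c) d * \<psi> (reindex c d) \<partial>data) =
      (\<integral>\<^sup>+x. \<psi> x \<partial>distr (density data (accept_weight (set c))) ?P (reindex c))"
    by (subst nn_integral_distr, measurable, subst nn_integral_density) auto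
  also have "\<dots> = ennreal (p ^ length c * (1 - p) ^ (n - length c)) * (\<integral>\<^sup>+x. \<psi> x \<partial>?P)"
    unfolding distr_reindex_accepted[OF c] by (rule nn_integral_scale_measure[OF \<psi>])
  also have "(\<integral>\<^sup>+x. \<psi> x \<partial>?P) = emeasure (?P \<Otimes>\<^sub>M \<nu>) G"
    unfolding \<psi>_def by (rule \<nu>.emeasure_pair_measure[OF G, symmetric])
  finally show "emeasure ?M Z = ennreal (p ^ length c * (1 - p) ^ (n - length c)) * emeasure R H *
        emeasure (?P \<Otimes>\<^sub>M \<nu>) G" by (simp add: mult_ac)
qed

end

section \<open>Splitting the accepted sample\<close>

lemma length_nths_calib:
  assumes "K \<subseteq> {..<length xs}"
  shows "length (nths xs K) = card K" and "length (nths xs (- K)) = length xs - card K"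
proof -
  have "{i. i < length xs \<and> i \<in> K} = K" "{i. i < length xs \<and> i \<in> - K} = {..<length xs} - K"
    using assms by auto
  then show "length (nths xs K) = card K" and "length (nths xs (- K)) = length xs - card K"
    using assms by (simp_all add: length_nths card_Diff_subset finite_subset)
qed

lemma calib_size_le: "\<gamma> < 1 \<Longrightarrow> calib_size \<gamma> N \<le> N"
  unfolding calib_size_def using mult_right_mono[of \<gamma> 1 "real N"] by (simp add: ceiling_le_iff)

lemma split_sizes_at_least:
  assumes "0 < \<gamma>" "\<gamma> < 1"
  obtains N0 where "\<And>N. N0 \<le> N \<Longrightarrow> L \<le> calib_size \<gamma> N \<and> L \<le> N - calib_size \<gamma> N"
proof (rule that)
  \<comment> \<open>The first term makes the calibration part large and the second the training
    part; the added 1 absorbs the ceiling in the calibration size.\<close>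
  fix N assume "nat \<lceil>max (real L / \<gamma>) ((real L + 1) / (1 - \<gamma>))\<rceil> \<le> N"
  then have "real L / \<gamma> \<le> real N" "(real L + 1) / (1 - \<gamma>) \<le> real N" by linarith+
  then have 1: "real L \<le> \<gamma> * real N" and 2: "real L + 1 \<le> (1 - \<gamma>) * real N"
    using assms by (simp_all add: field_simps)
  have "L \<le> calib_size \<gamma> N" using 1 unfolding calib_size_def by linarith
  moreover have "real (calib_size \<gamma> N) \<le> \<gamma> * real N + 1"
    using assms unfolding calib_size_def by (simp add: of_nat_nat)
  then have "real L + real (calib_size \<gamma> N) \<le> real N" using 2 by (simp add: algebra_simps)
  ultimately show "L \<le> calib_size \<gamma> N \<and> L \<le> N - calib_size \<gamma> N" by linarith
qed

text \<open>The accepted indices, training positions first and calibration positions last.\<close>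

definition split_order :: "nat \<Rightarrow> nat set \<Rightarrow> nat set \<Rightarrow> nat list" where
  "split_order n I K = (let js = filter (\<lambda>i. i \<in> I) [0..<n] in nths js (- K) @ nths js K)"

lemma split_order:
  assumes "I \<subseteq> {..<n}"
  shows distinct_split_order: "distinct (split_order n I K)"
    and set_split_order: "set (split_order n I K) = I"
    and length_split_order: "length (split_order n I K) = card I"
proof -
  define js where "js = filter (\<lambda>i. i \<in> I) [0..<n]"
  have js: "distinct js" "set js = I" using assms by (auto simp: js_def)
  have c: "split_order n I K = nths js (- K) @ nths js K" by (simp add: split_order_def js_def Let_def)
  show d: "distinct (split_order n I K)"
    using js(1) by (auto simp: c distinct_nthsI set_nths nth_eq_iff_index_eq)
  have "set (nths js (- K)) \<union> set (nths js K) = set js"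
    unfolding set_nths set_conv_nth[of js] by blast
  then show s: "set (split_order n I K) = I" by (simp add: c js)
  show "length (split_order n I K) = card I" using distinct_card[OF d] s by simp
qed

text \<open>
  The event that the interval is far from the oracle need not be measurable, so it is covered by a
  measurable set \<open>Z\<close>. It is a finite union over accepted index sets and calibration positions,
  since only the value of the splitting rule at the realised sample size matters.
\<close>

lemma (in rejection_sampling) rejection_exceptional_set:
  fixes R :: "(nat \<Rightarrow> nat set) measure"
  assumes "prob_space R" and R: "sets R = sets (split_space \<gamma>)"
    and G: "\<And>N. N0 \<le> N \<Longrightarrow> G N \<in> sets ((\<Pi>\<^sub>M j\<in>{..<N}. \<nu>) \<Otimes>\<^sub>M \<nu>)"
    and Gr: "\<And>N. N0 \<le> N \<Longrightarrow> emeasure ((\<Pi>\<^sub>M j\<in>{..<N}. \<nu>) \<Otimes>\<^sub>M \<nu>) (G N) \<le> ennreal r" and r: "0 \<le> r"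
  shows "\<exists>Z\<in>sets (data \<Otimes>\<^sub>M coins \<Otimes>\<^sub>M R \<Otimes>\<^sub>M \<nu>).
    emeasure (data \<Otimes>\<^sub>M coins \<Otimes>\<^sub>M R \<Otimes>\<^sub>M \<nu>) Z \<le> ennreal (binom_cdf n p (int N0 - 1) + r) \<and>
    (\<forall>d v j y I. (d, v, j, y) \<in> space (data \<Otimes>\<^sub>M coins \<Otimes>\<^sub>M R \<Otimes>\<^sub>M \<nu>) - Z \<longrightarrow> I = {i. i < n \<and> v i \<le> u (d i)} \<longrightarrow>
       N0 \<le> card I \<and> j (card I) \<subseteq> {..<card I} \<and> card (j (card I)) = calib_size \<gamma> (card I) \<and>
       reindex (split_order n I (j (card I))) d \<in> space (\<Pi>\<^sub>M j\<in>{..<card I}. \<nu>) \<and>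
       (reindex (split_order n I (j (card I))) d, y) \<notin> G (card I))"
proof -
  interpret R: prob_space R by fact
  let ?M = "data \<Otimes>\<^sub>M coins \<Otimes>\<^sub>M R \<Otimes>\<^sub>M \<nu>"
  let ?P = "\<lambda>N. \<Pi>\<^sub>M j\<in>{..<N}. \<nu>"
  define w where "w I = p ^ card I * (1 - p) ^ (n - card I)" for I :: "nat set"
  define \<K> where "\<K> N = {K. K \<subseteq> {..<N} \<and> card K = calib_size \<gamma> N}" for N
  define H where "H N K = {j \<in> space R. j N = K}" for N K
  \<comment> \<open>Only the acceptance condition is restrictive; the other two conjuncts are there
    to match \<open>emeasure_accepted_event\<close> with full sets, and the empty set of positions
    selects some enumeration of I.\<close>
  define Zs where "Zs I = {(d, v, j, y) \<in> space ?M. accepted I d v \<and> j \<in> space R \<and>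
      (reindex (split_order n I {}) d, y) \<in> space (?P (card I) \<Otimes>\<^sub>M \<nu>)}" for I
  define Zl where "Zl I K = {(d, v, j, y) \<in> space ?M. accepted I d v \<and> j \<in> H (card I) K \<and>
      (reindex (split_order n I K) d, y) \<in> G (card I)}" for I K
  define small where "small = {I. I \<subseteq> {..<n} \<and> card I < N0}"
  define large where "large = {I. I \<subseteq> {..<n} \<and> N0 \<le> card I}"
  define Z where "Z = (\<Union>I\<in>small. Zs I) \<union> (\<Union>I\<in>large. \<Union>K\<in>\<K> (card I). Zl I K)"
  have w0: "0 \<le> w I" for I using p by (simp add: w_def)
  have fin: "finite small" "finite large"
    by (rule finite_subset[of _ "Pow {..<n}"]; auto simp: small_def large_def)+
  have fin\<K>: "finite (\<K> N)" for N
    by (rule finite_subset[of _ "Pow {..<N}"]) (auto simp: \<K>_def)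
  have in\<K>: "j N \<in> \<K> N" if "j \<in> space R" for j N
    using that sets_eq_imp_space_eq[OF R] by (auto simp: split_space_def space_PiM PiE_iff \<K>_def)
  have H: "H N K \<in> sets R" if "K \<in> \<K> N" for N K
  proof -
    have "(\<lambda>j. j N) \<in> split_space \<gamma> \<rightarrow>\<^sub>M count_space (\<K> N)"
      unfolding split_space_def \<K>_def by (rule measurable_component_singleton) simp
    then have "(\<lambda>j. j N) \<in> R \<rightarrow>\<^sub>M count_space (\<K> N)" by (simp add: measurable_cong_sets[OF R refl])
    from measurable_sets[OF this, of "{K}"] that show ?thesis
      by (simp add: H_def vimage_def Int_def conj_commute)
  qed
  \<comment> \<open>The events that the rule picks K at size N are disjoint, so summing over K costs
    no factor however many splits there are.\<close>
  have sumH: "(\<Sum>K\<in>\<K> N. emeasure R (H N K)) \<le> 1" for N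
  proof -
    have "disjoint_family_on (H N) (\<K> N)" by (auto simp: disjoint_family_on_def H_def)
    then have "(\<Sum>K\<in>\<K> N. emeasure R (H N K)) = emeasure R (\<Union>K\<in>\<K> N. H N K)"
      using H fin\<K> by (intro sum_emeasure) auto
    also have "\<dots> \<le> 1" by (rule R.emeasure_le_1)
    finally show ?thesis .
  qed
  have Zs: "Zs I \<in> sets ?M" "emeasure ?M (Zs I) = ennreal (w I)" if "I \<in> small" for I
  proof -
    have I: "I \<subseteq> {..<n}" using that by (simp add: small_def)
    interpret \<nu>\<nu>: pair_prob_space "?P (card I)" \<nu>
      by (intro pair_prob_space.intro pair_sigma_finite.intro prob_space_imp_sigma_finite prob_space_PiM \<nu>.prob_space_axioms)
    note * = emeasure_accepted_event[OF distinct_split_order[OF I, of "{}"] _ assms(1) sets.top sets.top,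
        unfolded set_split_order[OF I] length_split_order[OF I], OF I]
    show "Zs I \<in> sets ?M" "emeasure ?M (Zs I) = ennreal (w I)"
      using * by (simp_all add: Zs_def w_def R.emeasure_space_1 \<nu>\<nu>.emeasure_space_1)
  qed
  have Zl: "Zl I K \<in> sets ?M" "emeasure ?M (Zl I K) \<le> ennreal (w I) * emeasure R (H (card I) K) * ennreal r"
    if "I \<in> large" "K \<in> \<K> (card I)" for I K
  proof -
    have I: "I \<subseteq> {..<n}" "N0 \<le> card I" using that by (auto simp: large_def)
    note * = emeasure_accepted_event[OF distinct_split_order[OF I(1), of K] _ assms(1) H[OF that(2)],
        unfolded set_split_order[OF I(1)] length_split_order[OF I(1)], OF I(1) G[OF I(2)]]
    show "Zl I K \<in> sets ?M" using *(1) by (simp add: Zl_def)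
    show "emeasure ?M (Zl I K) \<le> ennreal (w I) * emeasure R (H (card I) K) * ennreal r"
      unfolding Zl_def *(2) w_def by (intro mult_left_mono Gr I) auto
  qed
  have Z: "Z \<in> sets ?M"
    unfolding Z_def using fin fin\<K> Zs(1) Zl(1) by (intro sets.Un sets.finite_UN) auto
  have "emeasure ?M Z \<le> emeasure ?M (\<Union>I\<in>small. Zs I) + emeasure ?M (\<Union>I\<in>large. \<Union>K\<in>\<K> (card I). Zl I K)"
    unfolding Z_def using fin fin\<K> Zs(1) Zl(1) by (intro emeasure_subadditive sets.finite_UN) auto
  also have "\<dots> \<le> (\<Sum>I\<in>small. emeasure ?M (Zs I)) + (\<Sum>I\<in>large. \<Sum>K\<in>\<K> (card I). emeasure ?M (Zl I K))"
  proof (intro add_mono)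
    show "emeasure ?M (\<Union>I\<in>small. Zs I) \<le> (\<Sum>I\<in>small. emeasure ?M (Zs I))"
      using fin Zs(1) by (intro emeasure_subadditive_finite) auto
    have "emeasure ?M (\<Union>I\<in>large. \<Union>K\<in>\<K> (card I). Zl I K) \<le> (\<Sum>I\<in>large. emeasure ?M (\<Union>K\<in>\<K> (card I). Zl I K))"
      using fin fin\<K> Zl(1) by (intro emeasure_subadditive_finite) auto
    also have "\<dots> \<le> (\<Sum>I\<in>large. \<Sum>K\<in>\<K> (card I). emeasure ?M (Zl I K))"
      using fin\<K> Zl(1) by (intro sum_mono emeasure_subadditive_finite) auto
    finally show "emeasure ?M (\<Union>I\<in>large. \<Union>K\<in>\<K> (card I). Zl I K) \<le> (\<Sum>I\<in>large. \<Sum>K\<in>\<K> (card I). emeasure ?M (Zl I K))" .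
  qed
  also have "(\<Sum>I\<in>small. emeasure ?M (Zs I)) = ennreal (\<Sum>I\<in>small. w I)"
    using Zs(2) w0 by simp
  also have "(\<Sum>I\<in>small. w I) = binom_cdf n p (int N0 - 1)"
    unfolding w_def small_def by (rule sum_subsets_eq_binom_cdf[OF p])
  also have "(\<Sum>I\<in>large. \<Sum>K\<in>\<K> (card I). emeasure ?M (Zl I K)) \<le> (\<Sum>I\<in>large. ennreal (w I) * ennreal r)"
  proof (rule sum_mono)
    fix I assume I: "I \<in> large"
    have "(\<Sum>K\<in>\<K> (card I). emeasure ?M (Zl I K)) \<le> (\<Sum>K\<in>\<K> (card I). ennreal (w I) * emeasure R (H (card I) K) * ennreal r)"
      using Zl(2)[OF I] by (intro sum_mono)
    also have "\<dots> = ennreal (w I) * (\<Sum>K\<in>\<K> (card I). emeasure R (H (card I) K)) * ennreal r"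
      by (simp add: sum_distrib_left sum_distrib_right)
    also have "\<dots> \<le> ennreal (w I) * 1 * ennreal r"
      by (intro mult_right_mono mult_left_mono sumH) auto
    finally show "(\<Sum>K\<in>\<K> (card I). emeasure ?M (Zl I K)) \<le> ennreal (w I) * ennreal r" by simp
  qed
  also have "(\<Sum>I\<in>large. ennreal (w I) * ennreal r) = ennreal (\<Sum>I\<in>large. w I) * ennreal r"
    using w0 by (simp add: sum_distrib_right[symmetric])
  also have "\<dots> \<le> ennreal 1 * ennreal r"
  proof (intro mult_right_mono ennreal_leI)
    \<comment> \<open>The weights of all index sets form a binomial distribution function at n, so
      those of the large ones add up to at most 1.\<close>
    have "(\<Sum>I\<in>large. w I) \<le> (\<Sum>I | I \<subseteq> {..<n} \<and> card I < Suc n. w I)"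
    proof (intro sum_mono2)
      show "finite {I. I \<subseteq> {..<n} \<and> card I < Suc n}" by (rule finite_subset[of _ "Pow {..<n}"]) auto
      show "large \<subseteq> {I. I \<subseteq> {..<n} \<and> card I < Suc n}"
        using card_mono[of "{..<n}"] by (fastforce simp: large_def less_Suc_eq_le)
    qed (use w0 in auto)
    also have "\<dots> = binom_cdf n p (int (Suc n) - 1)"
      unfolding w_def by (rule sum_subsets_eq_binom_cdf[OF p])
    also have "\<dots> \<le> 1" unfolding binom_cdf_def by (rule measure_pmf.prob_le_1)
    finally show "(\<Sum>I\<in>large. w I) \<le> 1" .
  qed simp
  also have "ennreal (binom_cdf n p (int N0 - 1)) + ennreal 1 * ennreal r = ennreal (binom_cdf n p (int N0 - 1) + r)"
    using r by (simp add: binom_cdf_def)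
  finally have bound: "emeasure ?M Z \<le> ennreal (binom_cdf n p (int N0 - 1) + r)" by (simp add: add_mono)
  have "N0 \<le> card I \<and> j (card I) \<subseteq> {..<card I} \<and> card (j (card I)) = calib_size \<gamma> (card I) \<and>
       reindex (split_order n I (j (card I))) d \<in> space (?P (card I)) \<and>
       (reindex (split_order n I (j (card I))) d, y) \<notin> G (card I)"
    if sp: "(d, v, j, y) \<in> space ?M" and nZ: "(d, v, j, y) \<notin> Z" and I: "I = {i. i < n \<and> v i \<le> u (d i)}" for d v j y I
  proof -
    have In: "I \<subseteq> {..<n}" and acc: "accepted I d v" by (auto simp: I accepted_def)
    have j: "j \<in> space R" and d: "d \<in> space data" and y: "y \<in> space \<nu>" using sp by (auto simp: space_pair_measure)
    have rd: "reindex (split_order n I K) d \<in> space (?P (card I))" for K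
      using measurable_space[OF measurable_reindex[of "split_order n I K"] d] In
      by (simp add: set_split_order length_split_order)
    have "I \<notin> small"
    proof
      assume "I \<in> small"
      moreover have "(d, v, j, y) \<in> Zs I" using sp acc j rd y by (simp add: Zs_def space_pair_measure)
      ultimately show False using nZ unfolding Z_def by blast
    qed
    then have large: "I \<in> large" using In by (auto simp: small_def large_def)
    have K: "j (card I) \<in> \<K> (card I)" by (rule in\<K>[OF j])
    have "(reindex (split_order n I (j (card I))) d, y) \<notin> G (card I)"
    proof
      assume "(reindex (split_order n I (j (card I))) d, y) \<in> G (card I)"
      then have "(d, v, j, y) \<in> Zl I (j (card I))" using sp acc j by (simp add: Zl_def H_def)
      then show False using nZ large K unfolding Z_def by blast
    qed
    then show ?thesis using large K rd by (auto simp: large_def \<K>_def)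
  qed
  then show ?thesis using Z bound by blast
qed

section \<open>Convergence to the oracle interval\<close>

theorem theorem5:
  fixes PS :: "'s measure" and da :: "'a measure"
    and PR :: "'s \<times> 'a \<Rightarrow> real measure"
    and \<pi>b \<pi>e :: "'s \<Rightarrow> 'a \<Rightarrow> real"
    and \<epsilon> \<delta> \<gamma> \<epsilon>lo \<epsilon>up :: real
    and Qlo Qup :: "'s algorithm"
    and qlo qup :: "'s \<Rightarrow> real"
    and M :: "nat \<Rightarrow> 'w measure"
    and D :: "nat \<Rightarrow> nat \<Rightarrow> 'w \<Rightarrow> 's \<times> 'a \<times> real"
    and V :: "nat \<Rightarrow> nat \<Rightarrow> 'w \<Rightarrow> real"
    and J :: "nat \<Rightarrow> 'w \<Rightarrow> nat \<Rightarrow> nat set"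
    and T :: "nat \<Rightarrow> 'w \<Rightarrow> 's \<times> real"
  defines "\<nu> \<equiv> target_law PS da PR \<pi>e"
    and "B \<equiv> ratio_bound PS da \<pi>b \<pi>e"
  assumes "prob_space PS"
    and "PR \<in> PS \<Otimes>\<^sub>M da \<rightarrow>\<^sub>M prob_algebra borel"
    and "policy PS da \<pi>b" and "policy PS da \<pi>e"
    and "0 < \<epsilon>" "\<epsilon> < 1" and "0 < \<delta>" "\<delta> < 1" and "0 < \<gamma>" "\<gamma> < 1"
    and "B < \<infinity>"
    and "\<epsilon>lo \<in> {0..1}" "\<epsilon>up \<in> {0..1}" "\<epsilon>up - \<epsilon>lo = 1 - \<epsilon>"
    and "measurable_algorithm PS Qlo" "measurable_algorithm PS Qup"
    and sampling: "\<And>n. sampling_model (data_law PS da PR \<pi>b) \<nu> \<gamma> n (M n) (D n) (V n) (J n) (T n)"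
    and "qlo \<in> borel_measurable PS" "qup \<in> borel_measurable PS"
    and quantile_lo: "AE s in PS. is_quantile (cond_reward_law da PR \<pi>e s) \<epsilon>lo (qlo s)"
    and quantile_up: "AE s in PS. is_quantile (cond_reward_law da PR \<pi>e s) \<epsilon>up (qup s)"
    and consistency: "\<exists>\<eta> \<rho>. \<eta> \<longlonglongrightarrow> 0 \<and> \<rho> \<longlonglongrightarrow> 0 \<and>
          (\<forall>\<^sub>F l in sequentially.
             consistent_at \<nu> Qlo qlo l (\<eta> l) (\<rho> l) \<and> consistent_at \<nu> Qup qup l (\<eta> l) (\<rho> l))"
    and regularity: "\<exists>f c. distributed \<nu> lborel (score qlo qup) f \<and> c > 0 \<and>
          (\<forall>\<^sub>F t in nhds 0. ennreal c \<le> f t)"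
  shows "tends_to_zero_in_prob M (\<lambda>n \<omega>.
           let xs = rs_data (weight \<pi>b \<pi>e) (real_of_ereal B) n (\<lambda>i. D n i \<omega>) (\<lambda>i. V n i \<omega>);
               s = fst (T n \<omega>)
           in emeasure lborel
                (sym_diff (conformal_interval Qlo Qup \<epsilon> \<delta> (J n \<omega>) xs s) {qlo s..qup s}))"
proof -
  interpret contextual_bandit PS da PR
    by (intro contextual_bandit.intro contextual_bandit_axioms.intro assms)
  note \<pi>b = \<open>policy PS da \<pi>b\<close> and \<pi>e = \<open>policy PS da \<pi>e\<close>
  note \<epsilon> = \<open>0 < \<epsilon>\<close> \<open>\<epsilon> < 1\<close> and \<delta> = \<open>0 < \<delta>\<close> \<open>\<delta> < 1\<close> and \<gamma> = \<open>0 < \<gamma>\<close> \<open>\<gamma> < 1\<close>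
  note Q = \<open>measurable_algorithm PS Qlo\<close> \<open>measurable_algorithm PS Qup\<close>
  note q = \<open>qlo \<in> borel_measurable PS\<close> \<open>qup \<in> borel_measurable PS\<close>
  have diff: "\<epsilon>up - \<epsilon>lo = 1 - \<epsilon>" by fact
  have \<nu>: "prob_space \<nu>" "sets \<nu> = sets (PS \<Otimes>\<^sub>M borel)"
    unfolding \<nu>_def by (rule prob_space_target_law[OF \<pi>e] sets_target_law[OF \<pi>e])+
  define \<mu> where "\<mu> = data_law PS da PR \<pi>b"
  have \<mu>: "prob_space \<mu>" "sets \<mu> = sets (PS \<Otimes>\<^sub>M da \<Otimes>\<^sub>M borel)"
    unfolding \<mu>_def by (rule prob_space_data_law[OF \<pi>b] sets_data_law[OF \<pi>b])+
  obtain b where b: "B = ereal b" "1 \<le> b"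
    and bound: "\<And>s a. s \<in> space PS \<Longrightarrow> a \<in> space da \<Longrightarrow> \<pi>e s a \<le> b * \<pi>b s a"
    using ratio_bound_attained[OF \<pi>b \<pi>e] \<open>B < \<infinity>\<close> unfolding B_def by metis
  \<comment> \<open>Acceptance probability of a data point; the bound b keeps it at most 1, and
    \<open>1 / b\<close> becomes the overall acceptance rate.\<close>
  define u where "u = (\<lambda>(s, a, r::real). weight \<pi>b \<pi>e s a / b)"
  define \<phi> where "\<phi> = (\<lambda>(s::'s, a::'a, r::real). (s, r))"
  define p where "p = 1 / b"
  have p: "0 < p" "p \<le> 1" using b by (auto simp: p_def)
  interpret prod: rejection_sampling \<mu> \<nu> u \<phi> p n for n
  proof (intro rejection_sampling.intro rejection_sampling_axioms.intro \<mu>(1) \<nu>(1))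
    show "u \<in> borel_measurable \<mu>"
      unfolding u_def measurable_cong_sets[OF \<mu>(2) refl] split_beta
      using borel_measurable_weight[OF \<pi>b \<pi>e] by measurable
    show "\<phi> \<in> \<mu> \<rightarrow>\<^sub>M \<nu>"
      unfolding \<phi>_def measurable_cong_sets[OF \<mu>(2) \<nu>(2)] by measurable
    fix x assume "x \<in> space \<mu>"
    then obtain s a r where x: "x = (s, a, r)" "s \<in> space PS" "a \<in> space da"
      using sets_eq_imp_space_eq[OF \<mu>(2)] by (auto simp: space_pair_measure)
    then have "0 \<le> \<pi>b s a" "0 \<le> \<pi>e s a" "\<pi>e s a \<le> b * \<pi>b s a"
      using \<pi>b \<pi>e bound by (auto simp: policy_def)
    then show "0 \<le> u x \<and> u x \<le> 1"
      using b by (cases "\<pi>b s a = 0") (auto simp: x u_def weight_def field_simps)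
  next
    fix A assume "A \<in> sets \<nu>"
    then have A[measurable]: "A \<in> sets (PS \<Otimes>\<^sub>M borel)" using \<nu> by simp
    have "(\<integral>\<^sup>+x. ennreal (u x) * indicator A (\<phi> x) \<partial>\<mu>) =
        (\<integral>\<^sup>+(s, a, r). ennreal (weight \<pi>b \<pi>e s a / b) * indicator A (s, r) \<partial>\<mu>)"
      by (intro nn_integral_cong) (auto simp: u_def \<phi>_def)
    also have "\<dots> = ennreal (1 / b) * (\<integral>\<^sup>+x. indicator A x \<partial>\<nu>)"
      unfolding \<mu>_def \<nu>_def using b by (intro nn_integral_weight[OF \<pi>b \<pi>e _ bound]) auto
    finally show "(\<integral>\<^sup>+x. ennreal (u x) * indicator A (\<phi> x) \<partial>\<mu>) = ennreal p * emeasure \<nu> A"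
      using \<open>A \<in> sets \<nu>\<close> by (simp add: p_def)
  qed (use p in auto)

  have "\<epsilon>lo < \<epsilon>up" using diff \<epsilon> by linarith
  note mass = score_quantiles[OF \<pi>e this q quantile_lo quantile_up, folded \<nu>_def, unfolded diff]
  obtain f c where f: "distributed \<nu> lborel (score qlo qup) f" and c: "0 < c"
    and fc: "\<forall>\<^sub>F t in nhds 0. ennreal c \<le> f t" using regularity by (elim exE conjE)
  obtain t0 where t0: "0 < t0"
    and up: "\<And>t. 0 < t \<Longrightarrow> t \<le> t0 \<Longrightarrow> 1 - \<epsilon> + c * t \<le> measure \<nu> {x \<in> space \<nu>. score qlo qup x \<le> t}"
    and lo: "\<And>t. 0 < t \<Longrightarrow> t \<le> t0 \<Longrightarrow> measure \<nu> {x \<in> space \<nu>. score qlo qup x < - t} \<le> 1 - \<epsilon> - c * t"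
    using score_margin[OF \<nu>(1) f c fc mass] by blast
  obtain \<eta> \<rho> where \<eta>: "\<eta> \<longlonglongrightarrow> 0" and \<rho>: "\<rho> \<longlonglongrightarrow> 0" and cons: "\<forall>\<^sub>F l in sequentially.
      consistent_at \<nu> Qlo qlo l (\<eta> l) (\<rho> l) \<and> consistent_at \<nu> Qup qup l (\<eta> l) (\<rho> l)"
    using consistency by (elim exE conjE)

  define X where "X n \<omega> = emeasure lborel (sym_diff
      (conformal_interval Qlo Qup \<epsilon> \<delta> (J n \<omega>) (rs_data (weight \<pi>b \<pi>e) b n (\<lambda>i. D n i \<omega>) (\<lambda>i. V n i \<omega>)) (fst (T n \<omega>)))
      {qlo (fst (T n \<omega>))..qup (fst (T n \<omega>))})" for n \<omega>

  have "(\<lambda>n. measure (M n) {\<omega> \<in> space (M n). X n \<omega> > ennreal e}) \<longlonglongrightarrow> 0" if e: "0 < e" for e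
  proof (rule LIMSEQ_I)
    fix \<epsilon>' :: real assume \<epsilon>': "0 < \<epsilon>'"
    \<comment> \<open>One half is reserved for too few accepted pairs, the other for the exceptional
      sets G.\<close>
    define r where "r = \<epsilon>' / 2"
    define good where "good l m x y \<longleftrightarrow>
        \<bar>Qlo (map x [0..<l]) (fst y) - qlo (fst y)\<bar> \<le> e / 4 \<and> \<bar>Qup (map x [0..<l]) (fst y) - qup (fst y)\<bar> \<le> e / 4 \<and>
        \<bar>calib_threshold \<epsilon> \<delta> (map (score (Qlo (map x [0..<l])) (Qup (map x [0..<l]))) (map x [l..<l + m]))\<bar> \<le> ereal (e / 4)"
      for l m x and y :: "'s \<times> real"
    have r: "0 < r" using \<epsilon>' by (simp add: r_def)
    \<comment> \<open>Two quantile errors and a threshold of size at most e / 4 give a symmetric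
      difference of measure at most e.\<close>
    have "0 < e / 4" using e by simp
    from conformal_core[OF \<nu>(1) Q \<nu>(2) q \<epsilon> \<delta> \<eta> \<rho> cons c t0 up lo this r]
    obtain L where L: "\<And>l m. L \<le> l \<Longrightarrow> L \<le> m \<Longrightarrow> \<exists>G\<in>sets ((\<Pi>\<^sub>M i\<in>{..<l + m}. \<nu>) \<Otimes>\<^sub>M \<nu>).
        emeasure ((\<Pi>\<^sub>M i\<in>{..<l + m}. \<nu>) \<Otimes>\<^sub>M \<nu>) G \<le> ennreal r \<and>
        (\<forall>x\<in>space (\<Pi>\<^sub>M i\<in>{..<l + m}. \<nu>). \<forall>y\<in>space \<nu>. (x, y) \<notin> G \<longrightarrow> good l m x y)"
      unfolding good_def by blast
    obtain N0 where N0: "\<And>N. N0 \<le> N \<Longrightarrow> L \<le> calib_size \<gamma> N \<and> L \<le> N - calib_size \<gamma> N"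
      using split_sizes_at_least[OF \<gamma>] by blast
    define m where "m N = calib_size \<gamma> N" for N
    define l where "l N = N - m N" for N
    have lm: "l N + m N = N" for N using calib_size_le[OF \<gamma>(2), of N] by (simp add: l_def m_def)
    \<comment> \<open>One exceptional set for each sample size, gathered into a function so that the
      realised size can be inserted afterwards.\<close>
    have "\<exists>G. N0 \<le> N \<longrightarrow> G \<in> sets ((\<Pi>\<^sub>M i\<in>{..<N}. \<nu>) \<Otimes>\<^sub>M \<nu>) \<and>
        emeasure ((\<Pi>\<^sub>M i\<in>{..<N}. \<nu>) \<Otimes>\<^sub>M \<nu>) G \<le> ennreal r \<and>
        (\<forall>x\<in>space (\<Pi>\<^sub>M i\<in>{..<N}. \<nu>). \<forall>y\<in>space \<nu>. (x, y) \<notin> G \<longrightarrow> good (l N) (m N) x y)" for N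
      using L[of "l N" "m N", unfolded lm] N0[of N] unfolding l_def m_def by blast
    then obtain G where G: "\<And>N. N0 \<le> N \<Longrightarrow> G N \<in> sets ((\<Pi>\<^sub>M i\<in>{..<N}. \<nu>) \<Otimes>\<^sub>M \<nu>) \<and>
        emeasure ((\<Pi>\<^sub>M i\<in>{..<N}. \<nu>) \<Otimes>\<^sub>M \<nu>) (G N) \<le> ennreal r \<and>
        (\<forall>x\<in>space (\<Pi>\<^sub>M i\<in>{..<N}. \<nu>). \<forall>y\<in>space \<nu>. (x, y) \<notin> G N \<longrightarrow> good (l N) (m N) x y)"
      by metis
    \<comment> \<open>N0, G and r do not depend on n; only the probability of fewer than N0
      acceptances does, and it vanishes as n grows.\<close>
    have main: "measure (M n) {\<omega> \<in> space (M n). X n \<omega> > ennreal e} \<le> binom_cdf n p (int N0 - 1) + r" for n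
    proof -
      note model = sampling[of n, folded \<mu>_def, unfolded sampling_model_def]
      interpret Mn: prob_space "M n" using model by blast
      let ?S = "(\<Pi>\<^sub>M i\<in>{..<n}. \<mu>) \<Otimes>\<^sub>M (\<Pi>\<^sub>M i\<in>{..<n}. (borel :: real measure)) \<Otimes>\<^sub>M split_space \<gamma> \<Otimes>\<^sub>M \<nu>"
      let ?R = "distr (M n) (split_space \<gamma>) (J n)"
      let ?PM = "(\<Pi>\<^sub>M i\<in>{..<n}. \<mu>) \<Otimes>\<^sub>M (\<Pi>\<^sub>M i\<in>{..<n}. unif01) \<Otimes>\<^sub>M ?R \<Otimes>\<^sub>M \<nu>"
      define \<Phi> where "\<Phi> \<omega> = (\<lambda>i\<in>{..<n}. D n i \<omega>, \<lambda>i\<in>{..<n}. V n i \<omega>, J n \<omega>, T n \<omega>)" for \<omega>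
      have meas: "\<And>i. i \<in> {..<n} \<Longrightarrow> D n i \<in> M n \<rightarrow>\<^sub>M \<mu>" "\<And>i. i \<in> {..<n} \<Longrightarrow> V n i \<in> M n \<rightarrow>\<^sub>M borel"
          "J n \<in> M n \<rightarrow>\<^sub>M split_space \<gamma>" "T n \<in> M n \<rightarrow>\<^sub>M \<nu>"
        and law: "distr (M n) ?S \<Phi> = ?PM"
        using model unfolding \<Phi>_def by auto
      have \<Phi>: "\<Phi> \<in> M n \<rightarrow>\<^sub>M ?S"
        unfolding \<Phi>_def by (intro measurable_Pair measurable_restrict meas)
      have R: "prob_space ?R" by (rule Mn.prob_space_distr[OF meas(3)])
      obtain Z where Z: "Z \<in> sets ?PM" "emeasure ?PM Z \<le> ennreal (binom_cdf n p (int N0 - 1) + r)"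
        and nZ: "\<And>d v j y I. (d, v, j, y) \<in> space ?PM - Z \<Longrightarrow> I = {i. i < n \<and> v i \<le> u (d i)} \<Longrightarrow>
         N0 \<le> card I \<and> j (card I) \<subseteq> {..<card I} \<and> card (j (card I)) = calib_size \<gamma> (card I) \<and>
         prod.reindex (split_order n I (j (card I))) d \<in> space (\<Pi>\<^sub>M j\<in>{..<card I}. \<nu>) \<and>
         (prod.reindex (split_order n I (j (card I))) d, y) \<notin> G (card I)"
        using prod.rejection_exceptional_set[OF R, of \<gamma> N0 G r n] G r by (auto simp: sets_distr)
      have sub: "{\<omega> \<in> space (M n). X n \<omega> > ennreal e} \<subseteq> \<Phi> -` Z \<inter> space (M n)"
      proof (rule ccontr)
        assume "\<not> ?thesis"
        then obtain \<omega> where \<omega>: "\<omega> \<in> space (M n)" "X n \<omega> > ennreal e" "\<Phi> \<omega> \<notin> Z" by blast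
        define I where "I = {i. i < n \<and> V n i \<omega> \<le> u (D n i \<omega>)}"
        define js where "js = filter (\<lambda>i. i \<in> I) [0..<n]"
        define K where "K = J n \<omega> (card I)"
        \<comment> \<open>The accepted pairs rearranged into the fixed layout, training block first,
          to which the choice of G refers.\<close>
        define x where "x = prod.reindex (split_order n I K) (\<lambda>i\<in>{..<n}. D n i \<omega>)"
        let ?N = "card I"
        have "\<Phi> \<omega> \<in> space ?PM"
          using measurable_space[OF \<Phi> \<omega>(1)] unfolding law[symmetric] by simp
        then have "(\<lambda>i\<in>{..<n}. D n i \<omega>, \<lambda>i\<in>{..<n}. V n i \<omega>, J n \<omega>, T n \<omega>) \<in> space ?PM - Z"
          using \<omega>(3) unfolding \<Phi>_def by (rule DiffI)
        moreover have "I = {i. i < n \<and> (\<lambda>i\<in>{..<n}. V n i \<omega>) i \<le> u ((\<lambda>i\<in>{..<n}. D n i \<omega>) i)}"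
          by (auto simp: I_def)
        ultimately have ex: "N0 \<le> ?N" "K \<subseteq> {..<?N}" "card K = m ?N" "x \<in> space (\<Pi>\<^sub>M j\<in>{..<?N}. \<nu>)"
            "(x, T n \<omega>) \<notin> G ?N"
          using nZ[of "\<lambda>i\<in>{..<n}. D n i \<omega>" "\<lambda>i\<in>{..<n}. V n i \<omega>" "J n \<omega>" "T n \<omega>" I]
          unfolding K_def x_def m_def by blast+
        have "T n \<omega> \<in> space \<nu>" using measurable_space[OF meas(4) \<omega>(1)] .
        then have good: "good (l ?N) (m ?N) x (T n \<omega>)" using G[OF ex(1)] ex by blast
        have In: "I \<subseteq> {..<n}" by (auto simp: I_def)
        have js: "distinct js" "set js = I" using In by (auto simp: js_def)
        then have len: "length js = ?N" using distinct_card by fastforce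
        have data: "rs_data (weight \<pi>b \<pi>e) b n (\<lambda>i. D n i \<omega>) (\<lambda>i. V n i \<omega>) = map (\<lambda>i. \<phi> (D n i \<omega>)) js"
          unfolding rs_data_def js_def \<phi>_def
          by (intro arg_cong2[where f = map] refl filter_cong) (auto simp: I_def u_def split: prod.splits)
        have c: "split_order n I K = nths js (- K) @ nths js K"
          by (simp add: split_order_def js_def Let_def)
        have ln: "length (nths js (- K)) = l ?N" "length (nths js K) = m ?N"
          using length_nths_calib[of K js] ex(2,3) by (simp_all add: len l_def)
        have xc: "x i = \<phi> (D n ((nths js (- K) @ nths js K) ! i) \<omega>)" if "i < ?N" for i
        proof -
          have "(nths js (- K) @ nths js K) ! i \<in> I"
            using that set_split_order[OF In, of K] length_split_order[OF In, of K] unfolding c by (metis nth_mem)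
          then show ?thesis
            using that In length_split_order[OF In, of K] by (auto simp: x_def prod.reindex_def c)
        qed
        \<comment> \<open>Taking a sublist commutes with mapping, so the two blocks of x are exactly
          the training and calibration lists of the procedure, in the same order.\<close>
        have train: "map x [0..<l ?N] = map (\<lambda>i. \<phi> (D n i \<omega>)) (nths js (- K))"
          using lm[of ?N] ln by (intro nth_equalityI) (auto simp: xc nth_append)
        have calib: "map x [l ?N..<l ?N + m ?N] = map (\<lambda>i. \<phi> (D n i \<omega>)) (nths js K)"
          using lm[of ?N] ln by (intro nth_equalityI) (auto simp: xc nth_append)
        have "conformal_interval Qlo Qup \<epsilon> \<delta> (J n \<omega>) (map (\<lambda>i. \<phi> (D n i \<omega>)) js) =
          band (Qlo (map x [0..<l ?N])) (Qup (map x [0..<l ?N]))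
            (calib_threshold \<epsilon> \<delta> (map (score (Qlo (map x [0..<l ?N])) (Qup (map x [0..<l ?N]))) (map x [l ?N..<l ?N + m ?N])))"
          unfolding train calib conformal_interval_def by (simp add: len K_def nths_map Let_def)
        then have "X n \<omega> \<le> ennreal (4 * (e / 4))"
          using good unfolding X_def data good_def by (simp only:) (rule emeasure_sym_diff_band_le; blast)
        then show False using \<omega>(2) by simp
      qed
      \<comment> \<open>The equation for the joint law identifies the two sigma-algebras, one
        written with \<open>borel\<close> for the coins and the other with the uniform
        measure.\<close>
      have "Z \<in> sets ?S" using Z(1) unfolding law[symmetric] by simp
      then have "measure (M n) {\<omega> \<in> space (M n). X n \<omega> > ennreal e} \<le> measure (M n) (\<Phi> -` Z \<inter> space (M n))"
        using sub measurable_sets[OF \<Phi>] by (intro Mn.finite_measure_mono) auto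
      also have "\<dots> = measure ?PM Z"
        unfolding law[symmetric] using \<open>Z \<in> sets ?S\<close> by (simp add: measure_distr[OF \<Phi>])
      also have "\<dots> \<le> binom_cdf n p (int N0 - 1) + r"
        using Z(2) r unfolding measure_def by (intro enn2real_leI) (auto simp: binom_cdf_def)
      finally show ?thesis .
    qed
    have "\<forall>\<^sub>F n in sequentially. binom_cdf n p (int N0 - 1) < r"
      using binom_cdf_tendsto_0[OF p] r by (rule order_tendstoD)
    then obtain n0 where "\<And>n. n0 \<le> n \<Longrightarrow> binom_cdf n p (int N0 - 1) < r"
      by (auto simp: eventually_sequentially)
    then have "norm (measure (M n) {\<omega> \<in> space (M n). X n \<omega> > ennreal e} - 0) < \<epsilon>'" if "n0 \<le> n" for n
      using main[of n] that by (fastforce simp: r_def)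
    then show "\<exists>n0. \<forall>n\<ge>n0. norm (measure (M n) {\<omega> \<in> space (M n). X n \<omega> > ennreal e} - 0) < \<epsilon>'"
      by blast
  qed
  then show ?thesis unfolding tends_to_zero_in_prob_def X_def b(1) Let_def by simp
qed

end
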